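(* Let $p>3$ be a prime. Then $M_k(\Gamma_1(p))\setminus S_k(\Gamma_1(p))$ has $\eta$-quotients of level $p$ if and only if $\frac{p-1}{2}\mid k$. Furthermore, in that case, for $k>0$, there are exactly two $\eta$-quotients of level $p$ in $M_k(\Gamma_1(p))\setminus S_k(\Gamma_1(p))$, which are of the form $$\frac{\eta(pz)^{\frac{2pk}{p-1}}}{\eta(z)^{\frac{2k}{p-1}}}\quad\text{and}\quad\frac{\eta(z)^{\frac{2pk}{p-1}}}{\eta(pz)^{\frac{2k}{p-1}}}.$$
   Context: $k$ is an integer. $\eta(z)=q^{1/24}\prod_{n\ge1}(1-q^n)$ with $q=e^{2\pi i z}$, for $z$ in the upper half plane. An $\eta$-quotient of level $p$ ($p$ prime) is a function $\eta(z)^{r_1}\eta(pz)^{r_p}$ with $r_1,r_p\in\mathbb Z$; its weight is $\frac12(r_1+r_p)$. $\Gamma_1(p)$ is the group of matrices in $\mathrm{SL}_2(\mathbb Z)$ congruent to $\begin{pmatrix}1&*\\0&1\end{pmatrix}$ modulo $p$; $M_k(\Gamma_1(p))$ and $S_k(\Gamma_1(p))$ are the spaces of (holomorphic) modular forms and of cusp forms of weight $k$ for $\Gamma_1(p)$.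
   Formalization: The equivalence is stated with "k ≥ 0 and (p-1)/2 divides k" in place of "(p-1)/2 divides k": for negative k, e.g. p = 5 and k = -2, the space M_k(Γ_1(p)) is zero and contains no η-quotient although (p-1)/2 divides k. *)

theory Defs
  imports "HOL-Complex_Analysis.Complex_Analysis" "HOL-Number_Theory.Cong"
begin

definition upper_half_plane :: "complex set" where
  "upper_half_plane = {z. Im z > 0}"

text \<open>
  Functions on the upper half plane are represented by total functions that vanish outside it,
  so that equality of functions means equality on the upper half plane.
\<close>

definition on_uhp :: "(complex \<Rightarrow> complex) \<Rightarrow> complex \<Rightarrow> complex" where
  "on_uhp f = (\<lambda>z. if z \<in> upper_half_plane then f z else 0)"

definition SL2Z :: "(int^2^2) set" where
  "SL2Z = {A. det A = 1}"

definition Gamma1 :: "nat \<Rightarrow> (int^2^2) set" where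
  "Gamma1 N = {A \<in> SL2Z. [A $ 1 $ 1 = 1] (mod int N) \<and> [A $ 2 $ 1 = 0] (mod int N) \<and>
                          [A $ 2 $ 2 = 1] (mod int N)}"

definition moebius :: "int^2^2 \<Rightarrow> complex \<Rightarrow> complex" where
  "moebius A z = (of_int (A $ 1 $ 1) * z + of_int (A $ 1 $ 2)) /
                 (of_int (A $ 2 $ 1) * z + of_int (A $ 2 $ 2))"

definition slash :: "int \<Rightarrow> int^2^2 \<Rightarrow> (complex \<Rightarrow> complex) \<Rightarrow> complex \<Rightarrow> complex" where
  "slash k A f z =
     (of_int (A $ 2 $ 1) * z + of_int (A $ 2 $ 2)) powi (- k) * f (moebius A z)"

text \<open>
  \<open>fourier_expansion N g a\<close>: \<open>g\<close> is the sum of the series of \<open>a n * q_N ^ n\<close> over \<open>n \<ge> 0\<close>, where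
  \<open>q_N = exp (2 * pi * i * z / N)\<close>. The absence of negative exponents is
  holomorphy at infinity. The coefficients \<open>a\<close> are determined by \<open>g\<close> if \<open>N > 0\<close>.
\<close>

definition fourier_expansion ::
    "nat \<Rightarrow> (complex \<Rightarrow> complex) \<Rightarrow> (nat \<Rightarrow> complex) \<Rightarrow> bool" where
  "fourier_expansion N g a \<longleftrightarrow>
     (\<forall>z\<in>upper_half_plane.
        (\<lambda>n. a n * exp (2 * of_real pi * \<i> * z / of_nat N) ^ n) sums g z)"

text \<open>
  Every translate of a weight \<open>k\<close> invariant function under \<open>SL2Z\<close> has period \<open>N\<close>, because \<open>Gamma1 N\<close>
  contains the principal congruence subgroup of level \<open>N\<close>; hence the conditions at all cusps can
  be stated through expansions in \<open>q_N\<close>, whatever the widths of the cusps are.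
\<close>

definition modular_forms :: "int \<Rightarrow> nat \<Rightarrow> (complex \<Rightarrow> complex) set" where
  "modular_forms k N = {f.
     f holomorphic_on upper_half_plane \<and>
     (\<forall>z. z \<notin> upper_half_plane \<longrightarrow> f z = 0) \<and>
     (\<forall>A\<in>Gamma1 N. \<forall>z\<in>upper_half_plane. slash k A f z = f z) \<and>
     (\<forall>A\<in>SL2Z. \<exists>a. fourier_expansion N (slash k A f) a)}"

definition cusp_forms :: "int \<Rightarrow> nat \<Rightarrow> (complex \<Rightarrow> complex) set" where
  "cusp_forms k N = {f \<in> modular_forms k N.
     \<forall>A\<in>SL2Z. \<exists>a. fourier_expansion N (slash k A f) a \<and> a 0 = 0}"

definition dedekind_eta :: "complex \<Rightarrow> complex" where
  "dedekind_eta z = exp (2 * of_real pi * \<i> * z / 24) *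
     (\<Prod>n. 1 - exp (2 * of_real pi * \<i> * z) ^ Suc n)"

definition eta_quotients :: "nat \<Rightarrow> (complex \<Rightarrow> complex) set" where
  "eta_quotients p = {f. \<exists>r\<^sub>1 r\<^sub>p :: int.
     f = on_uhp (\<lambda>z. dedekind_eta z powi r\<^sub>1 * dedekind_eta (of_nat p * z) powi r\<^sub>p)}"

end

theory Submission
  imports Defs
begin

text \<open>
  Write \<open>f = eta(z)^p / eta(pz)\<close> and \<open>g = eta(pz)^p / eta(z)\<close>. All transformation laws come from the
  Klein forms, i.e. from the theta function \<open>theta(z, tau)\<close> with simple zeros on the lattice
  \<open>Z tau + Z\<close>: by Liouville's theorem it is determined up to a factor by its quasi-periods, hence it
  is modular, and the Klein forms transform under \<open>SL2Z\<close> with no root of unity at all.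
  The product of the three Klein forms at the points of order 2 is \<open>eta^(-6)\<close> up to a constant, which
  gives \<open>|eta(Az)| = |cz + d|^(1/2) |eta(z)|\<close>. The product of the Klein forms at \<open>(0, j/p)\<close>,
  \<open>1 \<le> j \<le> (p - 1)/2\<close>, is \<open>1/f\<close> up to a constant, and \<open>24\<close> divides \<open>p^2 - 1\<close>, so \<open>f\<close> is invariant
  under \<open>Gamma1(p)\<close>; \<open>g\<close> is proportional to the Fricke transform of \<open>f\<close> since their quotient has
  constant modulus.
  The absolute value of \<open>eta(Az)\<close> also yields the growth of \<open>eta(z)^r eta(pz)^s\<close> at every cusp: its order is
  proportional to \<open>r + ps\<close> or \<open>pr + s\<close>. A modular form that is not a cusp form needs both to be
  nonnegative and one of them to vanish, which together with \<open>r + s = 2k\<close> leaves the powers of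
  \<open>f\<close> and \<open>g\<close>.
\<close>

section \<open>Infinite products\<close>

text \<open>The exact multiplier of eta, a 24th root of unity, is never computed. Growth at the
  cusps and the weight need only absolute values, and for \<open>f\<close> the roots of unity are
  those of the Klein forms under integral translations, whose exponents are explicit. Summed over j
  they give N (p c' d' + 2 c' + 3 d') / 2, where c = p c', d = 1 + p d' and p^2 - 1 = 24 N; ad - bc
  = 1 makes the bracket even. The cusp conditions run over all A in SL2(Z), but the order at A
  depends only on whether p divides the lower left entry. If it does not, diag(p, 1) A is an SL2(Z)
  matrix times an upper triangular one with diagonal 1, p, so that eta(pz) is replaced by eta((z +
  beta) / p). Hence the two orders r + ps and r + s/p. Nonnegative orders force k to be nonnegative,
  since r + ps and pr + s add up to 2(p + 1)k. For k = 0 the two quotients coincide with the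
  constant 1, so there are two of them only for k > 0.\<close>

definition qpoch :: "complex \<Rightarrow> complex \<Rightarrow> complex" where
  "qpoch a q = (\<Prod>n. 1 - a * q ^ n)"

lemma convergent_qpoch:
  fixes a q :: complex
  assumes "norm q < 1"
  shows "convergent_prod (\<lambda>n. 1 - a * q ^ n)"
proof (rule abs_convergent_prod_imp_convergent_prod)
  have "summable (\<lambda>n. norm a * norm q ^ n)"
    using assms by (intro summable_mult summable_geometric) auto
  then show "abs_convergent_prod (\<lambda>n. 1 - a * q ^ n)"
    by (simp add: abs_convergent_prod_conv_summable norm_mult norm_power)
qed

lemma has_prod_qpoch: "norm q < 1 \<Longrightarrow> (\<lambda>n. 1 - a * q ^ n) has_prod qpoch a q"
  unfolding qpoch_def by (intro convergent_prod_has_prod convergent_qpoch)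

lemma qpoch_eq_0_iff: "norm q < 1 \<Longrightarrow> qpoch a q = 0 \<longleftrightarrow> (\<exists>n. a * q ^ n = 1)"
  using has_prod_eq_0_iff[OF has_prod_qpoch[of q a]] by auto

lemma qpoch_self_nonzero: "norm q < 1 \<Longrightarrow> qpoch q q \<noteq> 0"
proof
  assume q: "norm q < 1" "qpoch q q = 0"
  then obtain n where "q ^ Suc n = 1"
    by (auto simp: qpoch_eq_0_iff)
  then have "norm q ^ Suc n = 1"
    by (metis norm_one norm_power)
  with q show False
    using power_Suc_less_one[of "norm q" n] by (cases "q = 0") auto
qed

lemma qpoch_unfold:
  assumes "norm q < 1"
  shows "qpoch a q = (1 - a) * qpoch (a * q) q"
proof (rule has_prod_unique2[OF has_prod_qpoch[OF assms]])
  have "(\<lambda>n. 1 - a * q ^ Suc n) has_prod qpoch (a * q) q"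
    using has_prod_qpoch[OF assms, of "a * q"] by (simp add: mult.assoc)
  from has_prod_Suc_imp[OF this]
  show "(\<lambda>n. 1 - a * q ^ n) has_prod ((1 - a) * qpoch (a * q) q)"
    by (simp add: mult.commute)
qed

lemma qpoch_0 [simp]: "qpoch 0 q = 1"
  by (simp add: qpoch_def)

lemma qpoch_mult_uminus:
  assumes "norm q < 1"
  shows "qpoch a q * qpoch (- a) q = qpoch (a\<^sup>2) (q\<^sup>2)"
proof -
  have "norm (q\<^sup>2) < 1"
    using assms by (simp add: norm_power power_less_one_iff)
  from has_prod_qpoch[OF this, of "a\<^sup>2"]
  have "(\<lambda>n. (1 - a * q ^ n) * (1 - (- a) * q ^ n)) has_prod qpoch (a\<^sup>2) (q\<^sup>2)"
    by (rule has_prod_subst[rotated])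
      (simp add: fun_eq_iff algebra_simps power2_eq_square power_mult_distrib)
  moreover have "(\<lambda>n. (1 - a * q ^ n) * (1 - (- a) * q ^ n)) has_prod (qpoch a q * qpoch (- a) q)"
    by (intro has_prod_mult has_prod_qpoch assms)
  ultimately show ?thesis
    by (rule has_prod_unique2[rotated])
qed

text \<open>The polynomials X^p - 1 and the product \<open>P\<close> of the X - z over all p-th
  roots of unity z are both monic of degree p, so their difference has degree below p but p roots.
  The claim is their equality at 1/x, multiplied by x^p.\<close>

lemma prod_one_minus_roots_of_unity:
  fixes x :: complex
  assumes "p > 0"
  shows "(\<Prod>j<p. 1 - cis (2 * pi * real j / real p) * x) = 1 - x ^ p"
proof (cases "x = 0")
  case False
  define Z where "Z = {z :: complex. z ^ p = 1}"
  have bij: "bij_betw (\<lambda>k. cis (2 * pi * real k / real p)) {..<p} Z"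
    unfolding Z_def by (rule Complex.bij_betw_roots_unity[OF assms])
  have fin: "finite Z" and card: "card Z = p"
    using bij bij_betw_finite bij_betw_same_card by fastforce+
  define P where "P = (\<Prod>z\<in>Z. [:- z, 1:])"
  have deg: "degree P = p" and "lead_coeff P = 1"
    unfolding P_def lead_coeff_prod by (simp_all add: degree_prod_sum_eq card)
  then have lead: "coeff P p = 1"
    by simp
  define R where "R = monom 1 p - 1 - P"
  have "R = 0"
  proof (rule ccontr)
    assume "R \<noteq> 0"
    have "degree R \<le> p"
      unfolding R_def using deg by (intro degree_diff_le) (auto simp: degree_monom_eq)
    moreover have "coeff R p = 0"
      using lead assms by (simp add: R_def)
    ultimately have "degree R < p"
      using \<open>R \<noteq> 0\<close> by (metis leading_coeff_0_iff order_le_imp_less_or_eq)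
    moreover have "Z \<subseteq> {z. poly R z = 0}"
      using fin by (auto simp: R_def P_def Z_def poly_monom poly_prod)
    then have "p \<le> card {z. poly R z = 0}"
      using card \<open>R \<noteq> 0\<close> by (metis card_mono poly_roots_finite)
    ultimately show False
      using card_poly_roots_bound[OF \<open>R \<noteq> 0\<close>] by simp
  qed
  then have "poly (monom 1 p - 1) (1 / x) = poly P (1 / x)"
    by (simp add: R_def)
  then have "(1 / x) ^ p - 1 = (\<Prod>j<p. 1 / x - cis (2 * pi * real j / real p))"
    by (simp add: P_def poly_monom poly_prod prod.reindex_bij_betw[OF bij, symmetric])
  also have "\<dots> * x ^ p = (\<Prod>j<p. (1 / x - cis (2 * pi * real j / real p)) * x)"
    by (simp add: prod.distrib)
  also have "\<dots> = (\<Prod>j<p. 1 - cis (2 * pi * real j / real p) * x)"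
    using False by (intro prod.cong) (simp_all add: left_diff_distrib)
  finally show ?thesis
    using False by (simp add: left_diff_distrib power_one_over)
qed (use assms in auto)

text \<open>Used with \<open>a = q\<close>: it writes the infinite product in eta(p tau) as a
  product over p-th roots of unity of the products that occur in the theta function.\<close>

lemma qpoch_roots_of_unity:
  assumes "norm q < 1" "p > 0"
  shows "(\<Prod>j<p. qpoch (cis (2 * pi * real j / real p) * a) q) = qpoch (a ^ p) (q ^ p)"
proof (rule has_prod_unique2)
  show "(\<lambda>n. \<Prod>j<p. 1 - cis (2 * pi * real j / real p) * a * q ^ n) has_prod
         (\<Prod>j<p. qpoch (cis (2 * pi * real j / real p) * a) q)"
    by (intro has_prod_prod has_prod_qpoch assms)
  have "norm (q ^ p) < 1"
    using assms by (simp add: norm_power power_less_one_iff)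
  moreover have "(\<Prod>j<p. 1 - cis (2 * pi * real j / real p) * x) = 1 - x ^ p" for x
    by (rule prod_one_minus_roots_of_unity[OF assms(2)])
  ultimately show "(\<lambda>n. \<Prod>j<p. 1 - cis (2 * pi * real j / real p) * a * q ^ n) has_prod qpoch (a ^ p) (q ^ p)"
    using has_prod_qpoch[of "q ^ p" "a ^ p"]
    by (simp add: mult.assoc power_mult_distrib flip: power_mult) (simp add: mult.commute)
qed

text \<open>The factors are sorted by the parity of their index; the partial products with
  \<open>2 * n\<close> factors split exactly.\<close>

lemma qpoch_split2:
  assumes "norm q < 1"
  shows "qpoch a q = qpoch a (q\<^sup>2) * qpoch (a * q) (q\<^sup>2)"
proof -
  have q2: "norm (q\<^sup>2) < 1"
    using assms by (simp add: norm_power power_less_one_iff)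
  have part: "(\<Prod>i<2 * n. 1 - a * q ^ i) = (\<Prod>i<n. 1 - a * (q\<^sup>2) ^ i) * (\<Prod>i<n. 1 - a * q * (q\<^sup>2) ^ i)" for n
    by (induction n) (simp_all add: algebra_simps flip: power_mult)
  have "(\<lambda>n. \<Prod>i<n. 1 - a * q ^ i) \<longlonglongrightarrow> qpoch a q"
    using has_prod_imp_tendsto'[OF has_prod_qpoch[OF assms]] .
  then have "(\<lambda>n. \<Prod>i<2 * n. 1 - a * q ^ i) \<longlonglongrightarrow> qpoch a q"
    by (rule filterlim_compose) (simp add: filterlim_at_top_mult_tendsto_pos mult_nat_left_at_top)
  moreover have "(\<lambda>n. \<Prod>i<2 * n. 1 - a * q ^ i) \<longlonglongrightarrow> qpoch a (q\<^sup>2) * qpoch (a * q) (q\<^sup>2)"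
    unfolding part by (intro tendsto_mult has_prod_imp_tendsto' has_prod_qpoch q2)
  ultimately show ?thesis
    by (rule LIMSEQ_unique)
qed

text \<open>On a closed disc in \<open>S\<close> compactness gives |f| <= B and |g| <= r < 1, so the
  M-test with B r^n makes the partial products converge uniformly there.\<close>

lemma holomorphic_on_qpoch [holomorphic_intros]:
  assumes f: "f holomorphic_on S" and g: "g holomorphic_on S" and S: "open S"
    and g1: "\<And>z. z \<in> S \<Longrightarrow> norm (g z) < 1"
  shows "(\<lambda>z. qpoch (f z) (g z)) holomorphic_on S"
proof (rule holomorphic_uniform_sequence[OF S, of "\<lambda>n z. \<Prod>i<n. 1 - f z * g z ^ i"])
  fix z assume "z \<in> S"
  with S obtain d where d: "d > 0" "cball z d \<subseteq> S"
    by (meson open_contains_cball)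
  have cf: "continuous_on (cball z d) f" and cg: "continuous_on (cball z d) g"
    using f g d by (meson holomorphic_on_imp_continuous_on continuous_on_subset)+
  have "bounded (f ` cball z d)"
    by (intro compact_imp_bounded compact_continuous_image cf compact_cball)
  then obtain B where B: "\<And>w. w \<in> cball z d \<Longrightarrow> norm (f w) \<le> B"
    unfolding bounded_iff by blast
  obtain w0 where w0: "w0 \<in> cball z d" "\<And>w. w \<in> cball z d \<Longrightarrow> norm (g w) \<le> norm (g w0)"
    using continuous_attains_sup[of "cball z d" "\<lambda>w. norm (g w)"] continuous_on_norm[OF cg] d
    by (metis cball_eq_empty compact_cball not_less_iff_gr_or_eq)
  define r where "r = norm (g w0)"
  have r: "r < 1" "r \<ge> 0"
    using g1 w0 d by (auto simp: r_def)
  have "B \<ge> 0"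
    using B[of z] d by (metis centre_in_cball less_imp_le norm_ge_zero order_trans)
  have "uniformly_convergent_on (cball z d) (\<lambda>n z. \<Prod>i<n. 1 - f z * g z ^ i)"
  proof (rule uniformly_convergent_on_prod')
    show "continuous_on (cball z d) (\<lambda>z. 1 - f z * g z ^ n)" for n
      by (intro continuous_intros cf cg)
    show "uniformly_convergent_on (cball z d) (\<lambda>N x. \<Sum>n<N. norm (1 - f x * g x ^ n - 1))"
    proof (rule Weierstrass_m_test')
      show "summable (\<lambda>n. B * r ^ n)"
        using r by (intro summable_mult summable_geometric) auto
      show "norm (norm (1 - f w * g w ^ n - 1)) \<le> B * r ^ n" if "w \<in> cball z d" for n w
        using B[OF that] w0(2)[OF that] \<open>B \<ge> 0\<close>
        by (auto simp: norm_mult norm_power r_def intro!: mult_mono power_mono)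
    qed
  qed auto
  then obtain h where h: "uniform_limit (cball z d) (\<lambda>n z. \<Prod>i<n. 1 - f z * g z ^ i) h sequentially"
    by (auto simp: uniformly_convergent_on_def)
  have "h w = qpoch (f w) (g w)" if w: "w \<in> cball z d" for w
  proof (rule LIMSEQ_unique)
    show "(\<lambda>n. \<Prod>i<n. 1 - f w * g w ^ i) \<longlonglongrightarrow> h w"
      by (rule tendsto_uniform_limitI[OF h w])
    show "(\<lambda>n. \<Prod>i<n. 1 - f w * g w ^ i) \<longlonglongrightarrow> qpoch (f w) (g w)"
      using w d g1 by (intro has_prod_imp_tendsto' has_prod_qpoch) blast
  qed
  with h have "uniform_limit (cball z d) (\<lambda>n z. \<Prod>i<n. 1 - f z * g z ^ i) (\<lambda>z. qpoch (f z) (g z)) sequentially"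
    by (subst (asm) uniform_limit_cong') auto
  with d show "\<exists>d>0. cball z d \<subseteq> S \<and> uniform_limit (cball z d) (\<lambda>n z. \<Prod>i<n. 1 - f z * g z ^ i) (\<lambda>z. qpoch (f z) (g z)) sequentially"
    by blast
next
  show "(\<lambda>z. \<Prod>i<n. 1 - f z * g z ^ i) holomorphic_on S" for n
    by (intro holomorphic_on_prod holomorphic_on_diff holomorphic_on_mult
        holomorphic_on_power holomorphic_on_const f g)
qed

section \<open>The theta function\<close>

definition qexp :: "complex \<Rightarrow> complex" where
  "qexp z = exp (2 * of_real pi * \<i> * z)"

lemma qexp_0 [simp]: "qexp 0 = 1"
  by (simp add: qexp_def)

lemma qexp_nonzero [simp]: "qexp z \<noteq> 0"
  by (simp add: qexp_def)

lemma qexp_add: "qexp (x + y) = qexp x * qexp y"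
  by (simp add: qexp_def exp_add ring_distribs)

lemma qexp_minus: "qexp (- x) = inverse (qexp x)"
  by (simp add: qexp_def exp_minus)

lemma qexp_diff: "qexp (x - y) = qexp x / qexp y"
  by (simp add: qexp_def exp_diff ring_distribs)

lemma qexp_power: "qexp x ^ n = qexp (of_nat n * x)"
  by (simp add: qexp_def mult_ac flip: exp_of_nat_mult)

lemma norm_qexp: "norm (qexp z) = exp (- (2 * pi * Im z))"
  by (simp add: qexp_def)

lemma norm_qexp_less_1: "Im z > 0 \<Longrightarrow> norm (qexp z) < 1"
  by (simp add: norm_qexp)

lemma qexp_eq_1_iff: "qexp z = 1 \<longleftrightarrow> z \<in> \<int>"
proof -
  have "qexp z = 1 \<longleftrightarrow> (\<exists>n::int. z = of_int n)"
    unfolding qexp_def exp_eq_1 by (auto simp: complex_eq_iff)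
  then show ?thesis
    by (auto elim: Ints_cases)
qed

lemma qexp_eqI: "x - y \<in> \<int> \<Longrightarrow> qexp x = qexp y"
  using qexp_eq_1_iff[of "x - y"] by (simp add: qexp_diff)

lemma qexp_half: "qexp (1 / 2) = - 1"
  by (simp add: qexp_def)

lemma holomorphic_on_qexp [holomorphic_intros]:
  "f holomorphic_on S \<Longrightarrow> (\<lambda>z. qexp (f z)) holomorphic_on S"
  unfolding qexp_def by (intro holomorphic_intros)

lemma DERIV_qexp [derivative_intros]:
  "(f has_field_derivative f') (at z within S) \<Longrightarrow>
    ((\<lambda>z. qexp (f z)) has_field_derivative 2 * of_real pi * \<i> * f' * qexp (f z)) (at z within S)"
  unfolding qexp_def by (auto intro!: derivative_eq_intros)

text \<open>By the Jacobi triple product this is the odd Jacobi theta function up to a factor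
  depending only on tau. The sign makes it start with qexp(z/2) - qexp(-z/2), that is 2 i sin(pi
  z).\<close>

definition theta :: "complex \<Rightarrow> complex \<Rightarrow> complex" where
  "theta z \<tau> = - (qexp (- z / 2) * qpoch (qexp z) (qexp \<tau>) * qpoch (qexp (\<tau> - z)) (qexp \<tau>))"

definition lattice :: "complex \<Rightarrow> complex set" where
  "lattice \<tau> = {of_int m * \<tau> + of_int n | m n. True}"

context
  fixes \<tau> :: complex
  assumes tau: "Im \<tau> > 0"
begin

text \<open>The multiplier -1 is kept as \<open>qexp (1 / 2)\<close>, so that all multipliers can be
  collected in a single exponent by \<open>qexp_add\<close>.\<close>

lemma theta_add_1: "theta (z + 1) \<tau> = qexp (1 / 2) * theta z \<tau>"
proof -
  have "qexp (- (z + 1) / 2) = qexp (1 / 2) * qexp (- z / 2)"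
    unfolding qexp_add[symmetric] by (intro qexp_eqI) (simp add: field_simps)
  moreover have "qexp (z + 1) = qexp z" "qexp (\<tau> - (z + 1)) = qexp (\<tau> - z)"
    by (intro qexp_eqI; simp)+
  ultimately show ?thesis
    by (simp add: theta_def)
qed

text \<open>The shift by tau removes the first factor of one infinite product and adds one to the
  other; the two factors differ by a monomial in qexp(z).\<close>

lemma theta_add_tau: "theta (z + \<tau>) \<tau> = qexp (1 / 2 - \<tau> / 2 - z) * theta z \<tau>"
proof -
  have 1: "qpoch (qexp z) (qexp \<tau>) = (1 - qexp z) * qpoch (qexp (z + \<tau>)) (qexp \<tau>)"
    using qpoch_unfold[OF norm_qexp_less_1[OF tau], of "qexp z"] by (simp add: qexp_add)
  have 2: "qpoch (qexp (- z)) (qexp \<tau>) = (1 - qexp (- z)) * qpoch (qexp (\<tau> - z)) (qexp \<tau>)"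
    using qpoch_unfold[OF norm_qexp_less_1[OF tau], of "qexp (- z)"]
    by (simp add: qexp_diff qexp_minus field_simps)
  have 3: "qexp (- (z + \<tau>) / 2) * (1 - qexp (- z)) = qexp (1 / 2 - \<tau> / 2 - z) * qexp (- z / 2) * (1 - qexp z)"
  proof -
    have "qexp (1 / 2 - \<tau> / 2 - z) * qexp (- z / 2) * (1 - qexp z) =
        qexp (1 / 2) * qexp (- \<tau> / 2 - z - z / 2) - qexp (1 / 2) * qexp (- \<tau> / 2 - z / 2)"
      by (simp add: ring_distribs flip: qexp_add) (simp add: algebra_simps)
    also have "\<dots> = qexp (- \<tau> / 2 - z / 2) - qexp (- \<tau> / 2 - z / 2 - z)"
      by (simp add: qexp_half algebra_simps)
    also have "\<dots> = qexp (- (z + \<tau>) / 2) * (1 - qexp (- z))"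
      by (simp add: ring_distribs flip: qexp_add) (simp add: field_simps minus_diff_commute)
    finally show ?thesis ..
  qed
  have "theta (z + \<tau>) \<tau> = - (qexp (- (z + \<tau>) / 2) * qpoch (qexp (z + \<tau>)) (qexp \<tau>) * qpoch (qexp (- z)) (qexp \<tau>))"
    by (simp add: theta_def)
  also have "\<dots> = - (qexp (- (z + \<tau>) / 2) * (1 - qexp (- z)) * qpoch (qexp (z + \<tau>)) (qexp \<tau>) * qpoch (qexp (\<tau> - z)) (qexp \<tau>))"
    unfolding 2 by simp
  also have "\<dots> = qexp (1 / 2 - \<tau> / 2 - z) * theta z \<tau>"
    unfolding 3 theta_def 1 by simp
  finally show ?thesis .
qed

lemma theta_add_int: "theta (z + of_int n) \<tau> = qexp (of_int n / 2) * theta z \<tau>"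
proof (induction n arbitrary: z rule: int_induct[of _ 0])
  case (step1 n)
  have "theta (z + of_int (n + 1)) \<tau> = theta ((z + of_int n) + 1) \<tau>"
    by (simp add: add.assoc)
  also have "\<dots> = qexp (1 / 2) * qexp (of_int n / 2) * theta z \<tau>"
    by (simp add: theta_add_1 step1)
  finally show ?case
    by (simp add: add_divide_distrib mult_ac add_ac flip: qexp_add)
next
  case (step2 n)
  have "theta ((z + of_int (n - 1)) + 1) \<tau> = qexp (of_int n / 2) * theta z \<tau>"
    using step2(2)[of z] by simp
  then have "qexp (1 / 2) * theta (z + of_int (n - 1)) \<tau> = qexp (1 / 2 + of_int (n - 1) / 2) * theta z \<tau>"
    unfolding theta_add_1 by (simp add: diff_divide_distrib)
  then show ?case
    unfolding qexp_add by simp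
qed auto

lemma theta_add_int_tau:
  "theta (z + of_int m * \<tau>) \<tau> = qexp (of_int m / 2 - of_int (m\<^sup>2) * \<tau> / 2 - of_int m * z) * theta z \<tau>"
proof (induction m arbitrary: z rule: int_induct[of _ 0])
  case (step1 m)
  have "theta (z + of_int (m + 1) * \<tau>) \<tau> = theta ((z + of_int m * \<tau>) + \<tau>) \<tau>"
    by (simp add: algebra_simps)
  also have "\<dots> = qexp (1 / 2 - \<tau> / 2 - (z + of_int m * \<tau>)) *
      qexp (of_int m / 2 - of_int (m\<^sup>2) * \<tau> / 2 - of_int m * z) * theta z \<tau>"
    by (simp only: theta_add_tau step1 mult.assoc)
  finally show ?case
    by (simp add: power2_eq_square field_simps flip: qexp_add)
next
  case (step2 m)
  have "qexp (1 / 2 - \<tau> / 2 - (z + of_int (m - 1) * \<tau>)) * theta (z + of_int (m - 1) * \<tau>) \<tau> =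
      theta ((z + of_int (m - 1) * \<tau>) + \<tau>) \<tau>"
    by (simp only: theta_add_tau)
  also have "\<dots> = theta (z + of_int m * \<tau>) \<tau>"
    by (simp add: algebra_simps)
  also have "\<dots> = qexp (of_int m / 2 - of_int (m\<^sup>2) * \<tau> / 2 - of_int m * z) * theta z \<tau>"
    by (rule step2)
  also have "of_int m / 2 - of_int (m\<^sup>2) * \<tau> / 2 - of_int m * z =
      (1 / 2 - \<tau> / 2 - (z + of_int (m - 1) * \<tau>)) +
      (of_int (m - 1) / 2 - of_int ((m - 1)\<^sup>2) * \<tau> / 2 - of_int (m - 1) * z)"
    by (simp add: power2_eq_square field_simps)
  finally show ?case
    unfolding qexp_add by simp
qed auto

lemma theta_add_lattice:
  "theta (z + of_int m * \<tau> + of_int n) \<tau> =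
    qexp (of_int (m + n) / 2 - of_int (m\<^sup>2) * \<tau> / 2 - of_int m * z) * theta z \<tau>"
  unfolding theta_add_int theta_add_int_tau mult.assoc[symmetric] qexp_add[symmetric]
  by (simp add: add_divide_distrib algebra_simps)

text \<open>The first product vanishes at k - n tau and the second at (n + 1) tau - k, for natural n
  and integral k. Together these are the lattice points with coefficient of tau at most 0 and at
  least 1.\<close>

lemma theta_eq_0_iff: "theta z \<tau> = 0 \<longleftrightarrow> z \<in> lattice \<tau>"
proof -
  have "theta z \<tau> = 0 \<longleftrightarrow> (\<exists>n::nat. z + of_nat n * \<tau> \<in> \<int>) \<or> (\<exists>n::nat. \<tau> - z + of_nat n * \<tau> \<in> \<int>)"
    by (simp add: theta_def qpoch_eq_0_iff norm_qexp_less_1 tau qexp_power flip: qexp_add)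
      (simp add: qexp_eq_1_iff)
  also have "\<dots> \<longleftrightarrow> z \<in> lattice \<tau>"
  proof
    assume "(\<exists>n::nat. z + of_nat n * \<tau> \<in> \<int>) \<or> (\<exists>n::nat. \<tau> - z + of_nat n * \<tau> \<in> \<int>)"
    then show "z \<in> lattice \<tau>"
    proof (elim disjE exE)
      fix n :: nat assume "z + of_nat n * \<tau> \<in> \<int>"
      then obtain k :: int where "z + of_nat n * \<tau> = of_int k"
        by (elim Ints_cases)
      then have "z = of_int (- int n) * \<tau> + of_int k"
        by (simp add: algebra_simps eq_diff_eq)
      then show ?thesis
        unfolding lattice_def by blast
    next
      fix n :: nat assume "\<tau> - z + of_nat n * \<tau> \<in> \<int>"
      then obtain k :: int where "\<tau> - z + of_nat n * \<tau> = of_int k"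
        by (elim Ints_cases)
      then have "z = of_int (int n + 1) * \<tau> + of_int (- k)"
        by (simp add: algebra_simps eq_diff_eq)
      then show ?thesis
        unfolding lattice_def by blast
    qed
  next
    assume "z \<in> lattice \<tau>"
    then obtain m n :: int where z: "z = of_int m * \<tau> + of_int n"
      by (auto simp: lattice_def)
    show "(\<exists>n::nat. z + of_nat n * \<tau> \<in> \<int>) \<or> (\<exists>n::nat. \<tau> - z + of_nat n * \<tau> \<in> \<int>)"
    proof (cases "m \<le> 0")
      case True
      then have "z + of_nat (nat (- m)) * \<tau> = of_int n"
        by (simp add: z)
      then show ?thesis
        by (metis Ints_of_int)
    next
      case False
      then have "\<tau> - z + of_nat (nat (m - 1)) * \<tau> = of_int (- n)"
        by (simp add: z algebra_simps)
      then show ?thesis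
        by (metis Ints_of_int)
    qed
  qed
  finally show ?thesis .
qed

text \<open>The factor responsible for the zero at 0 is split off, which gives the derivative at
  0.\<close>

lemma theta_eq_sine_form:
  "theta z \<tau> = (qexp (z / 2) - qexp (- z / 2)) * (qpoch (qexp (z + \<tau>)) (qexp \<tau>) * qpoch (qexp (\<tau> - z)) (qexp \<tau>))"
proof -
  have "qpoch (qexp z) (qexp \<tau>) = (1 - qexp z) * qpoch (qexp (z + \<tau>)) (qexp \<tau>)"
    using qpoch_unfold[OF norm_qexp_less_1[OF tau], of "qexp z"] by (simp add: qexp_add)
  moreover have "- (qexp (- z / 2) * (1 - qexp z)) = qexp (z / 2) - qexp (- z / 2)"
    by (simp add: ring_distribs flip: qexp_add)
  ultimately show ?thesis
    unfolding theta_def by (metis (no_types, lifting) mult.assoc mult_minus_left)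
qed

lemma theta_holomorphic: "(\<lambda>z. theta z \<tau>) holomorphic_on S"
proof -
  have "(\<lambda>z. theta z \<tau>) holomorphic_on UNIV"
    unfolding theta_def by (intro holomorphic_intros) (auto simp: norm_qexp_less_1 tau)
  then show ?thesis
    using holomorphic_on_subset by blast
qed

lemma theta_deriv_0:
  "((\<lambda>z. theta z \<tau>) has_field_derivative 2 * of_real pi * \<i> * qpoch (qexp \<tau>) (qexp \<tau>) ^ 2) (at 0)"
proof -
  define B where "B z = qpoch (qexp (z + \<tau>)) (qexp \<tau>) * qpoch (qexp (\<tau> - z)) (qexp \<tau>)" for z
  have "B holomorphic_on UNIV"
    unfolding B_def by (intro holomorphic_intros) (auto simp: norm_qexp_less_1 tau)
  then obtain B' where B': "(B has_field_derivative B') (at 0)"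
    by (auto simp: holomorphic_on_def field_differentiable_def)
  have "((\<lambda>z. (qexp (z / 2) - qexp (- z / 2)) * B z) has_field_derivative
      2 * of_real pi * \<i> * B 0) (at 0)"
    by (auto intro!: derivative_eq_intros B')
  also have "(\<lambda>z. (qexp (z / 2) - qexp (- z / 2)) * B z) = (\<lambda>z. theta z \<tau>)"
    unfolding theta_eq_sine_form B_def ..
  also have "B 0 = qpoch (qexp \<tau>) (qexp \<tau>) ^ 2"
    by (simp add: B_def power2_eq_square)
  finally show ?thesis .
qed

end

section \<open>Modularity of the theta function and Klein forms\<close>

lemma int_period:
  fixes f :: "complex \<Rightarrow> 'a"
  assumes "\<And>z. f (z + w) = f z"
  shows "f (z + of_int n * w) = f z"
proof (induction n arbitrary: z rule: int_induct[of _ 0])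
  case (step1 n)
  have "f (z + of_int (n + 1) * w) = f ((z + of_int n * w) + w)"
    by (simp add: algebra_simps)
  with assms step1 show ?case
    by simp
next
  case (step2 n)
  have "f ((z + of_int (n - 1) * w) + w) = f (z + of_int n * w)"
    by (simp add: algebra_simps)
  with assms step2 show ?case
    by simp
qed auto

text \<open>H / theta is elliptic for Z tau + Z. As theta has a simple zero at 0, the quotient
  extends to 0 and, by periodicity, to all lattice points; it is then entire and bounded, hence
  constant. Comparing derivatives at 0 identifies the constant.\<close>

lemma theta_unique:
  fixes \<tau> D :: complex and H :: "complex \<Rightarrow> complex"
  assumes tau: "Im \<tau> > 0"
    and H: "H holomorphic_on UNIV"
    and H_add_1: "\<And>z. H (z + 1) = qexp (1 / 2) * H z"
    and H_add_tau: "\<And>z. H (z + \<tau>) = qexp (1 / 2 - \<tau> / 2 - z) * H z"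
    and H_0: "\<And>z. theta z \<tau> = 0 \<Longrightarrow> H z = 0"
    and D: "(H has_field_derivative D) (at 0)"
  shows "2 * of_real pi * \<i> * qpoch (qexp \<tau>) (qexp \<tau>) ^ 2 * H z = D * theta z \<tau>"
proof -
  define T where "T = 2 * of_real pi * \<i> * qpoch (qexp \<tau>) (qexp \<tau>) ^ 2"
  have T: "T \<noteq> 0"
    using qpoch_self_nonzero[OF norm_qexp_less_1[OF tau]] by (simp add: T_def)
  have [simp]: "theta 0 \<tau> = 0"
    by (simp add: theta_eq_sine_form tau)
  \<comment> \<open>At the zeros of theta the value is the limit of H / theta at 0, the quotient of
    the two derivatives; periodicity makes it right at every lattice point.\<close>
  define R where "R z = (if theta z \<tau> = 0 then D / T else H z / theta z \<tau>)" for z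
  have period: "R (z + of_int m * \<tau> + of_int n) = R z" for m n z
  proof -
    have "R (z + of_int n * 1) = R z" for z n
      by (rule int_period) (simp add: R_def theta_add_1[OF tau] H_add_1)
    moreover have "R (z + of_int m * \<tau>) = R z" for z m
      by (rule int_period) (simp add: R_def theta_add_tau[OF tau] H_add_tau)
    ultimately show ?thesis
      by simp
  qed
  have lim_theta: "(\<lambda>h. theta h \<tau> / h) \<midarrow>0\<rightarrow> T"
    using theta_deriv_0[OF tau] by (simp add: DERIV_def T_def)
  have "(\<lambda>h. H h / h) \<midarrow>0\<rightarrow> D"
    using D H_0[of 0] by (simp add: DERIV_def)
  then have "(\<lambda>h. (H h / h) / (theta h \<tau> / h)) \<midarrow>0\<rightarrow> D / T"
    using lim_theta T by (intro tendsto_divide)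
  then have lim: "(\<lambda>h. H h / theta h \<tau>) \<midarrow>0\<rightarrow> D / T"
    by (rule Lim_transform_eventually) (auto simp: eventually_at intro!: exI[of _ 1])
  have "eventually (\<lambda>h. theta h \<tau> / h \<noteq> 0) (at 0)"
    by (rule tendsto_imp_eventually_ne[OF lim_theta T])
  then obtain r where r: "r > 0" "\<And>h. h \<noteq> 0 \<Longrightarrow> norm h < r \<Longrightarrow> theta h \<tau> \<noteq> 0"
    by (auto simp: eventually_at)
  have "(\<lambda>y. if y = 0 then D / T else H y / theta y \<tau>) holomorphic_on ball 0 r"
  proof (rule removable_singularity)
    show "(\<lambda>y. H y / theta y \<tau>) holomorphic_on ball 0 r - {0}"
      using r by (intro holomorphic_on_divide theta_holomorphic tau holomorphic_on_subset[OF H]) auto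
  qed (use lim in auto)
  then have "R holomorphic_on ball 0 r"
    by (rule holomorphic_transform) (use r in \<open>auto simp: R_def\<close>)
  then obtain R' where R': "(R has_field_derivative R') (at 0)"
    using r by (meson centre_in_ball holomorphic_on_open open_ball)
  have "\<exists>f'. (R has_field_derivative f') (at w)" for w
  proof (cases "theta w \<tau> = 0")
    case True
    then obtain m n where w: "w = of_int m * \<tau> + of_int n"
      by (auto simp: theta_eq_0_iff[OF tau] lattice_def)
    \<comment> \<open>Differentiability at 0 is transported to the lattice point \<open>w\<close> by
      translation.\<close>
    have "R = (\<lambda>z. R (z + - w))"
      using period[of _ "- m" "- n"] by (simp add: w fun_eq_iff algebra_simps)
    moreover have "((\<lambda>z. R (z + - w)) has_field_derivative R') (at w)"
      using R' DERIV_shift[of R R' w "- w"] by simp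
    ultimately show ?thesis
      by metis
  next
    case False
    define S where "S = {z. theta z \<tau> \<noteq> 0}"
    have "continuous_on UNIV (\<lambda>z. theta z \<tau>)"
      by (intro holomorphic_on_imp_continuous_on theta_holomorphic tau)
    then have "open S"
      unfolding S_def by (intro open_Collect_neq continuous_on_const)
    have "(\<lambda>z. H z / theta z \<tau>) holomorphic_on S"
      by (intro holomorphic_on_divide theta_holomorphic tau holomorphic_on_subset[OF H]) (auto simp: S_def)
    then have "R holomorphic_on S"
      by (rule holomorphic_transform) (auto simp: R_def S_def)
    with \<open>open S\<close> False show ?thesis
      by (auto simp: holomorphic_on_open S_def)
  qed
  then have R_holo: "R holomorphic_on UNIV"
    by (simp add: holomorphic_on_open)
  \<comment> \<open>The closed period parallelogram, on which \<open>R\<close> takes all its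
    values.\<close>
  define K where "K = (\<lambda>(s, t). complex_of_real s * \<tau> + of_real t) ` ({0..1} \<times> {0..1})"
  have "compact K"
    unfolding K_def case_prod_unfold
    by (intro compact_continuous_image continuous_intros compact_Times compact_Icc)
  then have "bounded (R ` K)"
    using R_holo by (intro compact_imp_bounded compact_continuous_image)
      (meson holomorphic_on_imp_continuous_on continuous_on_subset subset_UNIV)
  moreover have "range R \<subseteq> R ` K"
  proof
    fix y assume "y \<in> range R"
    then obtain z where y: "y = R z"
      by auto
    define s t where "s = Im z / Im \<tau>" and "t = Re z - s * Re \<tau>"
    have z: "z = of_real s * \<tau> + of_real t"
      using tau by (simp add: complex_eq_iff s_def t_def)
    have "z + of_int (- \<lfloor>s\<rfloor>) * \<tau> + of_int (- \<lfloor>t\<rfloor>) = of_real (frac s) * \<tau> + of_real (frac t)"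
      unfolding frac_def by (subst z) (simp add: algebra_simps)
    moreover have "of_real (frac s) * \<tau> + of_real (frac t) \<in> K"
      unfolding K_def by (rule image_eqI[of _ _ "(frac s, frac t)"]) (auto simp: frac_lt_1 less_imp_le)
    ultimately show "y \<in> R ` K"
      using period[of z "- \<lfloor>s\<rfloor>" "- \<lfloor>t\<rfloor>"] y by (metis imageI)
  qed
  ultimately have "bounded (range R)"
    by (rule bounded_subset)
  then have "R constant_on UNIV"
    using R_holo Liouville_theorem by blast
  then have "R z = R 0"
    by (auto simp: constant_on_def)
  then have "T * H z = D * theta z \<tau>"
    using T H_0[of z] by (auto simp: R_def field_simps split: if_splits)
  then show ?thesis
    unfolding T_def .
qed

lemma modular_action_nonzero:
  fixes c d :: int
  assumes "Im \<tau> > 0" "c \<noteq> 0 \<or> d \<noteq> 0"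
  shows "of_int c * \<tau> + of_int d \<noteq> 0"
  using assms by (auto simp: complex_eq_iff)

lemma det_complex:
  fixes a b c d :: int
  assumes "a * d - b * c = 1"
  shows "of_int a * of_int d - of_int b * of_int c = (1 :: complex)"
  using assms by (metis of_int_1 of_int_diff of_int_mult)

context
  fixes a b c d :: int and \<tau> \<tau>' J :: complex
  assumes det: "a * d - b * c = 1" and tau: "Im \<tau> > 0"
  defines "J \<equiv> of_int c * \<tau> + of_int d"
  defines "\<tau>' \<equiv> (of_int a * \<tau> + of_int b) / J"
begin

lemma J_nonzero: "J \<noteq> 0"
  unfolding J_def using det by (intro modular_action_nonzero tau) auto

lemma Im_modular_action: "Im \<tau>' = Im \<tau> / (norm J)\<^sup>2"
proof -
  have "(c * Re \<tau> + d) * (a * Im \<tau>) - (a * Re \<tau> + b) * (c * Im \<tau>) = real_of_int (a * d - b * c) * Im \<tau>"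
    by (simp add: algebra_simps)
  then show ?thesis
    unfolding \<tau>'_def J_def det by (simp add: Im_divide cmod_power2 mult.commute)
qed

lemma Im_modular_action_pos: "Im \<tau>' > 0"
  using tau J_nonzero by (simp add: Im_modular_action)

text \<open>With \<open>tau_over_J\<close> this says that division by \<open>J\<close> maps the
  lattice Z tau + Z to Z tau' + Z; the coefficients come from the inverse matrix.\<close>

lemma one_over_J: "1 / J = of_int a - of_int c * \<tau>'"
proof -
  have "(of_int a - of_int c * \<tau>') * J = of_int a * J - of_int c * (of_int a * \<tau> + of_int b)"
    using J_nonzero by (simp add: \<tau>'_def field_simps)
  also have "\<dots> = of_int a * of_int d - of_int b * of_int c"
    by (simp add: J_def algebra_simps)
  finally show ?thesis
    using J_nonzero det_complex[OF det] by (simp add: field_simps)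
qed

lemma tau_over_J: "\<tau> / J = of_int d * \<tau>' - of_int b"
proof -
  have "(of_int d * \<tau>' - of_int b) * J = of_int d * (of_int a * \<tau> + of_int b) - of_int b * J"
    using J_nonzero by (simp add: \<tau>'_def field_simps)
  also have "\<dots> = (of_int a * of_int d - of_int b * of_int c) * \<tau>"
    by (simp add: J_def algebra_simps)
  finally show ?thesis
    using J_nonzero det_complex[OF det] by (simp add: field_simps)
qed

text \<open>As a function of z, theta(z / J, tau') has the zeros of theta(z, tau), and its
  quasi-periods are off by a Gaussian factor only. \<open>H\<close> includes the correction, so
  \<open>theta_unique\<close> applies; the factor in front is the ratio of the derivatives at
  0.\<close>

lemma theta_modular:
  "J * qpoch (qexp \<tau>) (qexp \<tau>) ^ 2 * theta (z / J) \<tau>' =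
    qpoch (qexp \<tau>') (qexp \<tau>') ^ 2 * qexp (of_int c * z\<^sup>2 / (2 * J)) * theta z \<tau>"
proof -
  define H where "H z = qexp (- of_int c * z\<^sup>2 / (2 * J)) * theta (z / J) \<tau>'" for z
  note tau' = Im_modular_action_pos
  define I where "I = 1 / J"
  have "I = of_int a - of_int c * \<tau>'"
    unfolding I_def by (rule one_over_J)
  moreover have "\<tau> * I = of_int d * \<tau>' - of_int b"
    using tau_over_J by (simp add: I_def)
  moreover have "J * I = 1"
    using J_nonzero by (simp add: I_def)
  ultimately have I: "I = of_int a - of_int c * \<tau>'" "\<tau> * I = of_int d * \<tau>' - of_int b" "J * I = 1"
    by blast+
  have H': "H z = qexp (- of_int c * z\<^sup>2 * I / 2) * theta (z * I) \<tau>'" for z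
    by (simp add: H_def I_def mult.commute)
  have "(\<lambda>z. z * I) holomorphic_on UNIV"
    by (intro holomorphic_intros)
  from holomorphic_on_compose[OF this theta_holomorphic[OF tau']]
  have theta_holo: "(\<lambda>z. theta (z * I) \<tau>') holomorphic_on UNIV"
    by (simp add: o_def)
  have H_holo: "H holomorphic_on UNIV"
    unfolding H' by (intro holomorphic_intros theta_holo) auto
  have "2 * of_real pi * \<i> * qpoch (qexp \<tau>) (qexp \<tau>) ^ 2 * H z =
      2 * of_real pi * \<i> * qpoch (qexp \<tau>') (qexp \<tau>') ^ 2 * I * theta z \<tau>"
  proof (rule theta_unique[OF tau H_holo])
    fix z
    have "theta ((z + 1) * I) \<tau>' = theta (z * I + of_int (- c) * \<tau>' + of_int a) \<tau>'"
      by (simp add: I algebra_simps)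
    then have "H (z + 1) = qexp (- of_int c * (z + 1)\<^sup>2 * I / 2 +
        (of_int (- c + a) / 2 - of_int ((- c)\<^sup>2) * \<tau>' / 2 - of_int (- c) * (z * I))) * theta (z * I) \<tau>'"
      by (simp only: H' theta_add_lattice[OF tau'] qexp_add mult.assoc)
    also have "\<dots> = qexp (1 / 2 + (- of_int c * z\<^sup>2 * I / 2)) * theta (z * I) \<tau>'"
    proof (intro arg_cong2[of _ _ _ _ "(*)"] qexp_eqI refl)
      have "odd (a * d - b * c)"
        using det by simp
      \<comment> \<open>Modulo 2 this is (a + 1)(c + 1), and a, c are not both even. The sign from
        the shift by the lattice point a - c tau' thus becomes the required -1.\<close>
      then have "even (a - c - c * a - 1)"
        by auto
      then obtain k where "a - c - c * a - 1 = 2 * k"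
        by (elim evenE)
      then have k: "of_int a - of_int c - of_int c * of_int a - 1 = (2 * of_int k :: complex)"
        by (metis of_int_1 of_int_diff of_int_mult of_int_numeral)
      have "(- of_int c * (z + 1)\<^sup>2 * I / 2 + (of_int (- c + a) / 2 - of_int ((- c)\<^sup>2) * \<tau>' / 2 - of_int (- c) * (z * I)))
          - (1 / 2 + (- of_int c * z\<^sup>2 * I / 2)) =
          (of_int a - of_int c - of_int c * (I + of_int c * \<tau>') - 1) / 2"
        by (simp add: power2_eq_square algebra_simps add_divide_distrib diff_divide_distrib)
      also have "I + of_int c * \<tau>' = of_int a"
        by (simp add: I)
      finally show "(- of_int c * (z + 1)\<^sup>2 * I / 2 + (of_int (- c + a) / 2 - of_int ((- c)\<^sup>2) * \<tau>' / 2 - of_int (- c) * (z * I)))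
          - (1 / 2 + (- of_int c * z\<^sup>2 * I / 2)) \<in> \<int>"
        by (simp add: k)
    qed
    finally show "H (z + 1) = qexp (1 / 2) * H z"
      by (simp only: H' qexp_add mult.assoc)
  next
    fix z
    have "theta ((z + \<tau>) * I) \<tau>' = theta (z * I + of_int d * \<tau>' + of_int (- b)) \<tau>'"
      unfolding distrib_right I(2) by (simp add: algebra_simps)
    then have "H (z + \<tau>) = qexp (- of_int c * (z + \<tau>)\<^sup>2 * I / 2 +
        (of_int (d + - b) / 2 - of_int (d\<^sup>2) * \<tau>' / 2 - of_int d * (z * I))) * theta (z * I) \<tau>'"
      by (simp only: H' theta_add_lattice[OF tau'] qexp_add mult.assoc)
    also have "\<dots> = qexp ((1 / 2 - \<tau> / 2 - z) + (- of_int c * z\<^sup>2 * I / 2)) * theta (z * I) \<tau>'"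
    proof (intro arg_cong2[of _ _ _ _ "(*)"] qexp_eqI refl)
      have "odd (a * d - b * c)"
        using det by simp
      \<comment> \<open>Modulo 2 this is (b + 1)(d + 1), and b, d are not both even.\<close>
      then have "even (d - b - d * b - 1)"
        by auto
      then obtain k where "d - b - d * b - 1 = 2 * k"
        by (elim evenE)
      then have k: "of_int d - of_int b - of_int d * of_int b - 1 = (2 * of_int k :: complex)"
        by (metis of_int_1 of_int_diff of_int_mult of_int_numeral)
      \<comment> \<open>The last two summands on the right are multiples of the relations
        \<open>I(3)\<close> and \<open>I(2)\<close>, hence zero; in this form the identity is purely
        polynomial.\<close>
      have "(- of_int c * (z + \<tau>)\<^sup>2 * I / 2 + (of_int (d + - b) / 2 - of_int (d\<^sup>2) * \<tau>' / 2 - of_int d * (z * I)))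
          - ((1 / 2 - \<tau> / 2 - z) + (- of_int c * z\<^sup>2 * I / 2)) =
          (of_int d - of_int b - of_int d * of_int b - 1) / 2 + (z + \<tau> / 2) * (1 - J * I)
          + of_int d * (\<tau> * I - (of_int d * \<tau>' - of_int b)) / 2"
        by (simp add: power2_eq_square algebra_simps add_divide_distrib diff_divide_distrib J_def)
      also have "\<dots> = of_int k"
        unfolding k I(2) I(3) by simp
      finally show "(- of_int c * (z + \<tau>)\<^sup>2 * I / 2 + (of_int (d + - b) / 2 - of_int (d\<^sup>2) * \<tau>' / 2 - of_int d * (z * I)))
          - ((1 / 2 - \<tau> / 2 - z) + (- of_int c * z\<^sup>2 * I / 2)) \<in> \<int>"
        by simp
    qed
    finally show "H (z + \<tau>) = qexp (1 / 2 - \<tau> / 2 - z) * H z"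
      by (simp only: H' qexp_add mult.assoc)
  next
    fix z assume "theta z \<tau> = 0"
    then obtain m n where z: "z = of_int m * \<tau> + of_int n"
      by (auto simp: theta_eq_0_iff[OF tau] lattice_def)
    have "z * I = of_int m * (\<tau> * I) + of_int n * I"
      by (simp add: z algebra_simps)
    also have "\<dots> = of_int (m * d - n * c) * \<tau>' + of_int (n * a - m * b)"
      unfolding I(2) by (simp add: I(1) algebra_simps)
    finally have "z * I \<in> lattice \<tau>'"
      unfolding lattice_def by blast
    then show "H z = 0"
      by (simp add: H' theta_eq_0_iff[OF tau'])
  next
    have "((\<lambda>z. z * I) has_field_derivative I) (at 0)"
      by (auto intro!: derivative_eq_intros)
    then have "((\<lambda>z. theta (z * I) \<tau>') has_field_derivative
        2 * of_real pi * \<i> * qpoch (qexp \<tau>') (qexp \<tau>') ^ 2 * I) (at 0)"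
      using DERIV_chain2[of "\<lambda>z. theta z \<tau>'" _ "\<lambda>z. z * I" 0 I UNIV] theta_deriv_0[OF tau'] by simp
    moreover have "theta 0 \<tau>' = 0"
      by (simp add: theta_eq_sine_form tau')
    ultimately show "(H has_field_derivative 2 * of_real pi * \<i> * qpoch (qexp \<tau>') (qexp \<tau>') ^ 2 * I) (at 0)"
      unfolding H' by (auto intro!: derivative_eq_intros)
  qed
  then have "qpoch (qexp \<tau>) (qexp \<tau>) ^ 2 * H z = qpoch (qexp \<tau>') (qexp \<tau>') ^ 2 * I * theta z \<tau>"
    by (simp add: mult.assoc)
  moreover have "theta (z / J) \<tau>' = qexp (of_int c * z\<^sup>2 / (2 * J)) * H z"
    by (simp add: H_def qexp_minus)
  ultimately show ?thesis
    using J_nonzero by (simp add: I_def field_simps)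
qed

end

text \<open>The Klein form at the point u tau + v, up to a constant normalization. Division by the
  squared product normalizes the derivative of theta at 0, and the exponential prefactor absorbs the
  Gaussian factor of \<open>theta_modular\<close>.\<close>

definition klein :: "complex \<Rightarrow> complex \<Rightarrow> complex \<Rightarrow> complex" where
  "klein u v \<tau> = qexp (u * (u * \<tau> + v) / 2) * theta (u * \<tau> + v) \<tau> / qpoch (qexp \<tau>) (qexp \<tau>) ^ 2"

text \<open>The row vector (u, v) is multiplied by the matrix from the right. The identity u + c z =
  u' J merges the prefactor at tau' and the Gaussian factor into the prefactor u' z / 2 at tau, so
  no multiplier remains.\<close>

lemma klein_modular:
  fixes a b c d :: int
  assumes det: "a * d - b * c = 1" and tau: "Im \<tau> > 0"
  shows "klein u v ((of_int a * \<tau> + of_int b) / (of_int c * \<tau> + of_int d)) =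
      klein (u * of_int a + v * of_int c) (u * of_int b + v * of_int d) \<tau> / (of_int c * \<tau> + of_int d)"
proof -
  define J \<tau>' where "J = of_int c * \<tau> + of_int d" and "\<tau>' = (of_int a * \<tau> + of_int b) / J"
  define u' v' where "u' = u * of_int a + v * of_int c" and "v' = u * of_int b + v * of_int d"
  define z where "z = u' * \<tau> + v'"
  note facts = det tau
  have J: "J \<noteq> 0" and tau': "Im \<tau>' > 0"
    using J_nonzero[OF facts] Im_modular_action_pos[OF facts] by (simp_all add: J_def \<tau>'_def)
  have P: "qpoch (qexp \<tau>) (qexp \<tau>) \<noteq> 0" "qpoch (qexp \<tau>') (qexp \<tau>') \<noteq> 0"
    using tau tau' by (simp_all add: qpoch_self_nonzero norm_qexp_less_1)
  have zJ: "u * \<tau>' + v = z / J"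
    using J by (simp add: \<tau>'_def z_def u'_def v'_def field_simps) (simp add: J_def algebra_simps)
  have uz: "u + of_int c * z = u' * J"
  proof -
    have "u + of_int c * z = u * (1 + of_int b * of_int c) + (u' * of_int c * \<tau> + of_int c * of_int d * v)"
      by (simp add: z_def v'_def algebra_simps)
    also have "1 + of_int b * of_int c = (of_int a * of_int d :: complex)"
      using det_complex[OF det] by (simp add: algebra_simps)
    finally show ?thesis
      by (simp add: J_def u'_def algebra_simps)
  qed
  have "u * (z / J) / 2 + of_int c * z\<^sup>2 / (2 * J) = (u + of_int c * z) * z / (2 * J)"
    by (simp add: power2_eq_square algebra_simps add_divide_distrib)
  also have "\<dots> = u' * z / 2"
    unfolding uz using J by simp
  finally have expo: "qexp (u * (z / J) / 2) * qexp (of_int c * z\<^sup>2 / (2 * J)) = qexp (u' * z / 2)"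
    by (simp only: flip: qexp_add)
  have "J * qpoch (qexp \<tau>) (qexp \<tau>) ^ 2 * theta (z / J) \<tau>' =
      qpoch (qexp \<tau>') (qexp \<tau>') ^ 2 * qexp (of_int c * z\<^sup>2 / (2 * J)) * theta z \<tau>"
    unfolding J_def \<tau>'_def by (rule theta_modular[OF facts])
  then have th: "theta (z / J) \<tau>' / qpoch (qexp \<tau>') (qexp \<tau>') ^ 2 =
      qexp (of_int c * z\<^sup>2 / (2 * J)) * theta z \<tau> / qpoch (qexp \<tau>) (qexp \<tau>) ^ 2 / J"
    using J P by (simp add: field_simps)
  have "klein u v \<tau>' = qexp (u * (z / J) / 2) * (theta (z / J) \<tau>' / qpoch (qexp \<tau>') (qexp \<tau>') ^ 2)"
    by (simp add: klein_def zJ)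
  also have "\<dots> = qexp (u' * z / 2) * theta z \<tau> / qpoch (qexp \<tau>) (qexp \<tau>) ^ 2 / J"
    unfolding th expo[symmetric] by simp
  also have "\<dots> = klein u' v' \<tau> / J"
    by (simp add: klein_def z_def)
  finally show ?thesis
    by (simp add: J_def \<tau>'_def u'_def v'_def)
qed

text \<open>The quadratic terms in tau cancel between the prefactor and theta. For rational u, v the
  remaining factor is a root of unity.\<close>

lemma klein_shift:
  fixes m n :: int
  assumes tau: "Im \<tau> > 0"
  shows "klein (u + of_int m) (v + of_int n) \<tau> =
    qexp ((of_int (m * n + m + n) - of_int m * v + of_int n * u) / 2) * klein u v \<tau>"
proof -
  define z where "z = u * \<tau> + v"
  have z: "(u + of_int m) * \<tau> + (v + of_int n) = z + of_int m * \<tau> + of_int n"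
    by (simp add: z_def algebra_simps)
  have "(u + of_int m) * (z + of_int m * \<tau> + of_int n) / 2 +
      (of_int (m + n) / 2 - of_int (m\<^sup>2) * \<tau> / 2 - of_int m * z) =
      (of_int (m * n + m + n) - of_int m * v + of_int n * u) / 2 + u * z / 2"
    by (simp add: z_def power2_eq_square algebra_simps add_divide_distrib diff_divide_distrib)
  then have "qexp ((u + of_int m) * (z + of_int m * \<tau> + of_int n) / 2) *
      qexp (of_int (m + n) / 2 - of_int (m\<^sup>2) * \<tau> / 2 - of_int m * z) =
      qexp ((of_int (m * n + m + n) - of_int m * v + of_int n * u) / 2) * qexp (u * z / 2)"
    unfolding qexp_add[symmetric] by simp
  then show ?thesis
    unfolding klein_def z theta_add_lattice[OF tau] z_def[symmetric]
    by (simp add: field_simps)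
qed

section \<open>Transformation of eta\<close>

lemma dedekind_eta_qexp: "dedekind_eta \<tau> = qexp (\<tau> / 24) * qpoch (qexp \<tau>) (qexp \<tau>)"
  by (simp add: dedekind_eta_def qexp_def qpoch_def)

lemma dedekind_eta_nonzero: "Im \<tau> > 0 \<Longrightarrow> dedekind_eta \<tau> \<noteq> 0"
  by (simp add: dedekind_eta_qexp qpoch_self_nonzero norm_qexp_less_1)

text \<open>The infinite products combine to Euler's identity that the product of all (1 + q^n)(1 -
  q^(2n - 1)) is 1. The two factors of modulus |q|^(-1/8) cancel against eta^6, and the 2 is the
  zeroth factor of \<open>qpoch (- 1) q\<close>.\<close>

lemma norm_klein_halves:
  assumes tau: "Im \<tau> > 0"
  shows "norm (klein (1 / 2) 0 \<tau>) * norm (klein 0 (1 / 2) \<tau>) * norm (klein (1 / 2) (1 / 2) \<tau>) *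
      norm (dedekind_eta \<tau>) ^ 6 = 2"
proof -
  define q x where "q = qexp \<tau>" and "x = qexp (\<tau> / 2)"
  have q: "norm q < 1"
    by (simp add: q_def norm_qexp_less_1 tau)
  have x2: "x\<^sup>2 = q"
    by (simp add: x_def q_def qexp_power)
  have q2: "norm (q\<^sup>2) < 1"
    using q by (simp add: norm_power power_less_one_iff)
  define P where "P = qpoch q q"
  have "qpoch q (q\<^sup>2) * qpoch (q\<^sup>2) (q\<^sup>2) = P"
    using qpoch_split2[OF q, of q] by (simp add: P_def power2_eq_square)
  moreover have "P * qpoch (- q) q = qpoch (q\<^sup>2) (q\<^sup>2)"
    using qpoch_mult_uminus[OF q, of q] by (simp add: P_def)
  moreover have "P \<noteq> 0"
    using qpoch_self_nonzero[OF q] by (simp add: P_def)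
  ultimately have "qpoch (- q) q * qpoch q (q\<^sup>2) = 1"
    by (metis (no_types, lifting) mult.assoc mult.commute mult_cancel_left mult.right_neutral)
  moreover have "qpoch x q * qpoch (- x) q = qpoch q (q\<^sup>2)"
    using qpoch_mult_uminus[OF q, of x] by (simp add: x2)
  ultimately have Euler: "qpoch (- q) q * (qpoch x q * qpoch (- x) q) = 1"
    by simp
  have minus: "qexp (z + 1 / 2) = - qexp z" "qexp (z - 1 / 2) = - qexp z" for z
    by (simp_all add: qexp_add qexp_diff qexp_half)
  have "klein (1 / 2) 0 \<tau> = - (qexp (\<tau> / 8) * qexp (- \<tau> / 4) * qpoch x q ^ 2 / P ^ 2)"
    by (simp add: klein_def theta_def P_def q_def x_def power2_eq_square)
  then have 1: "norm (klein (1 / 2) 0 \<tau>) = norm (qexp (- \<tau> / 8)) * norm (qpoch x q) ^ 2 / norm P ^ 2"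
    by (simp add: norm_mult norm_divide norm_power norm_qexp flip: exp_add)
  have "klein 0 (1 / 2) \<tau> = - (qexp (- 1 / 4) * qpoch (- 1) q * qpoch (- q) q / P ^ 2)"
    by (simp add: klein_def theta_def P_def q_def minus qexp_half)
  also have "qpoch (- 1) q = 2 * qpoch (- q) q"
    using qpoch_unfold[OF q, of "- 1"] by simp
  finally have 2: "norm (klein 0 (1 / 2) \<tau>) = 2 * norm (qpoch (- q) q) ^ 2 / norm P ^ 2"
    by (simp add: norm_mult norm_divide norm_power norm_qexp power2_eq_square)
  have "klein (1 / 2) (1 / 2) \<tau> = - (qexp ((\<tau> / 2 + 1 / 2) / 4) * qexp (- (\<tau> / 2 + 1 / 2) / 2) * qpoch (- x) q ^ 2 / P ^ 2)"
  proof -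
    have "qexp (\<tau> / 2 + 1 / 2) = - x" "qexp (\<tau> - (\<tau> / 2 + 1 / 2)) = - x"
      using minus[of "\<tau> / 2"] by (simp_all add: x_def field_simps)
    moreover have "1 / 2 * (1 / 2 * \<tau> + 1 / 2) / 2 = (\<tau> / 2 + 1 / 2) / 4"
      by simp
    ultimately show ?thesis
      by (simp add: klein_def theta_def P_def q_def power2_eq_square)
  qed
  then have 3: "norm (klein (1 / 2) (1 / 2) \<tau>) = norm (qexp (- \<tau> / 8)) * norm (qpoch (- x) q) ^ 2 / norm P ^ 2"
    by (simp add: norm_mult norm_divide norm_power norm_qexp flip: exp_add)
  have "norm (qexp (\<tau> / 24)) ^ 6 * norm (qexp (- \<tau> / 8)) ^ 2 = 1"
    by (simp add: norm_qexp flip: exp_of_nat_mult exp_add)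
  moreover have "norm (dedekind_eta \<tau>) ^ 6 = norm (qexp (\<tau> / 24)) ^ 6 * norm P ^ 6"
    by (simp add: dedekind_eta_qexp P_def q_def norm_mult power_mult_distrib)
  ultimately have "norm (klein (1 / 2) 0 \<tau>) * norm (klein 0 (1 / 2) \<tau>) * norm (klein (1 / 2) (1 / 2) \<tau>) *
      norm (dedekind_eta \<tau>) ^ 6 = 2 * norm (qpoch (- q) q * (qpoch x q * qpoch (- x) q)) ^ 2"
    unfolding 1 2 3 norm_mult using \<open>P \<noteq> 0\<close>
    by (simp add: field_simps power2_eq_square eval_nat_numeral)
  then show ?thesis
    unfolding Euler by simp
qed

text \<open>An integral translation multiplies the Klein form by \<open>qexp\<close> of a real
  number, which has modulus 1.\<close>

lemma norm_klein_half_parity: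
  fixes u v :: int
  assumes tau: "Im \<tau> > 0"
  shows "norm (klein (of_int u / 2) (of_int v / 2) \<tau>) =
      norm (klein (of_bool (odd u) / 2) (of_bool (odd v) / 2) \<tau>)"
proof -
  have u: "of_int u / 2 = of_bool (odd u) / 2 + (of_int (u div 2) :: complex)"
    and v: "of_int v / 2 = of_bool (odd v) / 2 + (of_int (v div 2) :: complex)"
    by (auto elim!: evenE oddE simp: field_simps)
  have "Im ((of_int m - of_int n * of_bool b / 2 + of_int k * of_bool c / 2) / 2) = 0" for m n k :: int and b c
    by simp
  then show ?thesis
    unfolding u v klein_shift[OF tau] norm_mult norm_qexp by simp
qed

text \<open>The three Klein forms at points of order 2 are permuted up to modulus and each
  contributes 1 / |J|, so |eta|^6 acquires |J|^3; sixth roots of nonnegative numbers are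
  unique.\<close>

lemma norm_eta_modular:
  fixes a b c d :: int
  assumes det: "a * d - b * c = 1" and tau: "Im \<tau> > 0"
  shows "norm (dedekind_eta ((of_int a * \<tau> + of_int b) / (of_int c * \<tau> + of_int d))) =
      sqrt (norm (of_int c * \<tau> + of_int d)) * norm (dedekind_eta \<tau>)"
proof -
  define J \<tau>' where "J = of_int c * \<tau> + of_int d" and "\<tau>' = (of_int a * \<tau> + of_int b) / J"
  have J: "J \<noteq> 0" and tau': "Im \<tau>' > 0"
    using J_nonzero[OF det tau] Im_modular_action_pos[OF det tau] by (simp_all add: J_def \<tau>'_def)
  define h where "h u v = norm (klein (of_int u / 2) (of_int v / 2) \<tau>)" for u v :: int
  have h: "h u v = h (of_bool (odd u)) (of_bool (odd v))" for u v
    using norm_klein_half_parity[OF tau, of u v] by (simp add: h_def)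
  have mod: "norm (klein (of_int u / 2) (of_int v / 2) \<tau>') = h (u * a + v * c) (u * b + v * d) / norm J" for u v :: int
    unfolding J_def \<tau>'_def klein_modular[OF det tau] h_def
    by (simp add: norm_divide add_divide_distrib)
  have "odd (a * d - b * c)"
    using det by simp
  \<comment> \<open>As the determinant is odd, the rows (a, b), (c, d) and their sum are the three
    nonzero vectors modulo 2.\<close>
  then have perm: "h a b * h c d * h (a + c) (b + d) = h 1 0 * h 0 1 * h 1 1"
    unfolding h[of a b] h[of c d] h[of "a + c" "b + d"] by auto
  have "h 1 0 * h 0 1 * h 1 1 * norm (dedekind_eta \<tau>) ^ 6 = 2"
    using norm_klein_halves[OF tau] by (simp add: h_def)
  moreover have "h a b * h c d * h (a + c) (b + d) / norm J ^ 3 * norm (dedekind_eta \<tau>') ^ 6 = 2"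
    using norm_klein_halves[OF tau'] mod[of 1 0] mod[of 0 1] mod[of 1 1]
    by (simp add: power3_eq_cube)
  ultimately have "h 1 0 * h 0 1 * h 1 1 * norm (dedekind_eta \<tau>') ^ 6 =
      h 1 0 * h 0 1 * h 1 1 * (norm J ^ 3 * norm (dedekind_eta \<tau>) ^ 6)"
    and "h 1 0 * h 0 1 * h 1 1 \<noteq> 0"
    unfolding perm using J by (auto simp: field_simps)
  then have "norm (dedekind_eta \<tau>') ^ 6 = norm J ^ 3 * norm (dedekind_eta \<tau>) ^ 6"
    by simp
  also have "\<dots> = (sqrt (norm J) * norm (dedekind_eta \<tau>)) ^ 6"
  proof -
    have "sqrt (norm J) ^ 6 = (sqrt (norm J) ^ 2) ^ 3"
      unfolding power_mult[symmetric] by simp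
    then show ?thesis
      by (simp add: power_mult_distrib)
  qed
  finally have "norm (dedekind_eta \<tau>') = sqrt (norm J) * norm (dedekind_eta \<tau>)"
    by (rule power_eq_imp_eq_base) auto
  then show ?thesis
    by (simp add: J_def \<tau>'_def)
qed

lemma klein_0: "Im \<tau> > 0 \<Longrightarrow> klein 0 v \<tau> = (qexp (v / 2) - qexp (- v / 2)) *
    (qpoch (qexp v * qexp \<tau>) (qexp \<tau>) * qpoch (qexp (- v) * qexp \<tau>) (qexp \<tau>)) / qpoch (qexp \<tau>) (qexp \<tau>) ^ 2"
  by (simp add: klein_def theta_eq_sine_form flip: qexp_add)

text \<open>The points j/p and -j/p with 1 <= j <= n account for all nontrivial p-th roots of unity,
  so the products in the Klein forms give that of eta(p tau) divided by that of eta(tau). The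
  fractional powers of q in the eta quotient cancel, and only the sine factors survive in the
  constant.\<close>

lemma eta_quotient_klein:
  fixes n :: nat
  defines "p \<equiv> 2 * n + 1"
  obtains C where "C \<noteq> 0"
    "\<And>\<tau>. Im \<tau> > 0 \<Longrightarrow> (\<Prod>j=1..n. klein 0 (of_nat j / of_nat p) \<tau>) *
      (dedekind_eta \<tau> ^ p / dedekind_eta (of_nat p * \<tau>)) = C"
proof
  \<comment> \<open>This is 2 i sin(pi j / p), nonzero because p does not divide j.\<close>
  define s where "s j = qexp (of_nat j / of_nat p / 2) - qexp (- (of_nat j / of_nat p) / 2)" for j :: nat
  show "(\<Prod>j=1..n. s j) \<noteq> 0"
  proof -
    have "s j \<noteq> 0" if j: "j \<in> {1..n}" for j
    proof
      assume "s j = 0"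
      then have "qexp (of_nat j / of_nat p) = 1"
        using qexp_add[of "of_nat j / of_nat p / 2" "of_nat j / of_nat p / 2"]
        by (simp add: s_def qexp_minus field_simps)
      then obtain k where "(of_nat j :: complex) / of_nat p = of_int k"
        by (auto simp: qexp_eq_1_iff elim: Ints_cases)
      then have "(of_int (int j) :: complex) = of_int (k * int p)"
        using of_nat_neq_0[of "2 * n", where 'a = complex] unfolding p_def
        by (simp add: divide_eq_eq split: if_splits)
      then have "int j = k * int p"
        by (simp only: of_int_eq_iff)
      moreover have "0 < int j" "int j < int p"
        using j by (auto simp: p_def)
      ultimately show False
        by (metis zdvd_not_zless dvd_triv_right)
    qed
    then show ?thesis
      by simp
  qed
  fix \<tau> :: complex assume tau: "Im \<tau> > 0"
  define q where "q = qexp \<tau>"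
  have q: "norm q < 1"
    by (simp add: q_def norm_qexp_less_1 tau)
  define P where "P = qpoch q q"
  have P: "P \<noteq> 0"
    using qpoch_self_nonzero[OF q] by (simp add: P_def)
  have P': "qpoch (q ^ p) (q ^ p) \<noteq> 0"
    using q by (intro qpoch_self_nonzero) (simp add: norm_power power_less_one_iff p_def del: power_Suc)
  define g where "g j = qpoch (qexp (of_nat j / of_nat p) * q) q" for j :: nat
  have "{..<p} = insert 0 ({1..n} \<union> {n+1..2*n})"
    by (auto simp: p_def)
  then have "(\<Prod>j<p. g j) = g 0 * ((\<Prod>j=1..n. g j) * (\<Prod>j=n+1..2*n. g j))"
    by (simp add: prod.union_disjoint)
  also have "(\<Prod>j=n+1..2*n. g j) = (\<Prod>j=1..n. g (p - j))"
    by (rule prod.reindex_bij_witness[of _ "\<lambda>j. p - j" "\<lambda>j. p - j"]) (auto simp: p_def)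
  also have "(\<Prod>j<p. g j) = qpoch (q ^ p) (q ^ p)"
    using qpoch_roots_of_unity[OF q, of p q]
    by (simp add: g_def p_def qexp_def cis_conv_exp mult_ac)
  also have "g 0 = P"
    by (simp add: g_def P_def)
  finally have g: "qpoch (q ^ p) (q ^ p) = P * ((\<Prod>j=1..n. g j) * (\<Prod>j=1..n. g (p - j)))" .
  have "klein 0 (of_nat j / of_nat p) \<tau> = s j * (g j * g (p - j)) / P ^ 2" if "j \<in> {1..n}" for j
  proof -
    have "j \<le> p"
      using that by (simp add: p_def)
    moreover have "(of_nat p :: complex) \<noteq> 0"
      unfolding of_nat_eq_0_iff by (simp add: p_def)
    ultimately have "- (of_nat j / of_nat p) - of_nat (p - j) / of_nat p = (- 1 :: complex)"
      by (simp add: of_nat_diff diff_divide_distrib)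
    then have "qexp (- (of_nat j / of_nat p)) = qexp (of_nat (p - j) / of_nat p)"
      by (intro qexp_eqI) simp
    then show ?thesis
      by (simp add: klein_0 tau s_def g_def P_def q_def)
  qed
  then have "(\<Prod>j=1..n. klein 0 (of_nat j / of_nat p) \<tau>) = (\<Prod>j=1..n. s j * (g j * g (p - j)) / P ^ 2)"
    by (intro prod.cong) auto
  also have "\<dots> = (\<Prod>j=1..n. s j) * ((\<Prod>j=1..n. g j) * (\<Prod>j=1..n. g (p - j))) / P ^ (2 * n)"
    by (simp add: prod.distrib prod_dividef power_mult)
  finally have klein: "(\<Prod>j=1..n. klein 0 (of_nat j / of_nat p) \<tau>) =
      (\<Prod>j=1..n. s j) * ((\<Prod>j=1..n. g j) * (\<Prod>j=1..n. g (p - j))) / P ^ (2 * n)" .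
  have "dedekind_eta \<tau> ^ p / dedekind_eta (of_nat p * \<tau>) = P ^ p / qpoch (q ^ p) (q ^ p)"
    by (simp add: dedekind_eta_qexp power_mult_distrib qexp_power q_def P_def)
  also have "P ^ p = P ^ (2 * n) * P"
    by (simp add: p_def)
  finally have eta: "dedekind_eta \<tau> ^ p / dedekind_eta (of_nat p * \<tau>) = P ^ (2 * n) * P / qpoch (q ^ p) (q ^ p)" .
  define G where "G = (\<Prod>j=1..n. g j) * (\<Prod>j=1..n. g (p - j))"
  have "G \<noteq> 0"
    using P' g by (auto simp: G_def)
  then show "(\<Prod>j=1..n. klein 0 (of_nat j / of_nat p) \<tau>) *
      (dedekind_eta \<tau> ^ p / dedekind_eta (of_nat p * \<tau>)) = (\<Prod>j=1..n. s j)"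
    unfolding klein eta g G_def[symmetric] using P by simp
qed

lemma sum_of_nat_closed: "(\<Sum>j=1..n. of_nat j) = (of_nat (n * (n + 1)) / 2 :: complex)"
  by (induction n) (auto simp: field_simps)

lemma sum_of_nat_square_closed:
  "(\<Sum>j=1..n. of_nat j ^ 2) = (of_nat (n * (n + 1) * (2 * n + 1)) / 6 :: complex)"
  by (induction n) (auto simp: field_simps power2_eq_square)

text \<open>Only the residue of p modulo 24 matters, and it is divisible by neither 2 nor 3; the
  remaining residues are checked one by one.\<close>

lemma prime_square_mod_24:
  fixes p :: nat
  assumes "prime p" "p > 3"
  shows "[p\<^sup>2 = 1] (mod 24)"
proof -
  have "m = 1 \<or> m = p" if "m dvd p" for m
    using assms(1) that by (simp add: prime_nat_iff)
  from this[of 2] this[of 3] have "\<not> 2 dvd p mod 24" "\<not> 3 dvd p mod 24"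
    using assms(2) by (auto simp: dvd_mod_iff)
  moreover have "list_all (\<lambda>r. 2 dvd r \<or> 3 dvd r \<or> r * r mod 24 = 1) [0..<24::nat]"
    by code_simp
  then have "2 dvd r \<or> 3 dvd r \<or> r * r mod 24 = 1" if "r < 24" for r :: nat
    using that unfolding list_all_iff by (metis atLeastLessThan_iff set_upt zero_le)
  then have "2 dvd p mod 24 \<or> 3 dvd p mod 24 \<or> (p mod 24) * (p mod 24) mod 24 = 1"
    by this simp
  ultimately have "(p mod 24)\<^sup>2 mod 24 = 1"
    unfolding power2_eq_square by blast
  then show ?thesis
    by (simp add: cong_def power_mod)
qed

text \<open>A matrix in Gamma1(p) moves (0, j/p) by an integral vector, so the product of Klein
  forms is multiplied by J^(-n) and by \<open>qexp\<close> of the sum of the \<open>e j\<close>.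
  That sum is an integer.\<close>

lemma eta_quotient_Gamma1:
  fixes a b c d :: int and p :: nat
  assumes p: "prime p" "p > 3"
    and det: "a * d - b * c = 1" and tau: "Im \<tau> > 0"
    and cong: "[d = 1] (mod int p)" "[c = 0] (mod int p)" "[a = 1] (mod int p)"
  defines "f \<equiv> \<lambda>\<tau>. dedekind_eta \<tau> ^ p / dedekind_eta (of_nat p * \<tau>)"
  shows "f ((of_int a * \<tau> + of_int b) / (of_int c * \<tau> + of_int d)) =
      (of_int c * \<tau> + of_int d) ^ ((p - 1) div 2) * f \<tau>"
proof -
  define n where "n = (p - 1) div 2"
  have "odd p"
    using p prime_odd_nat by auto
  then have pn: "p = 2 * n + 1"
    by (auto simp: n_def elim!: oddE)
  define J \<tau>' where "J = of_int c * \<tau> + of_int d" and "\<tau>' = (of_int a * \<tau> + of_int b) / J"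
  have J: "J \<noteq> 0" and tau': "Im \<tau>' > 0"
    using J_nonzero[OF det tau] Im_modular_action_pos[OF det tau] by (simp_all add: J_def \<tau>'_def)
  obtain C where C: "C \<noteq> 0" "\<And>\<tau>. Im \<tau> > 0 \<Longrightarrow> (\<Prod>j=1..n. klein 0 (of_nat j / of_nat p) \<tau>) * f \<tau> = C"
    using eta_quotient_klein[of n] that unfolding f_def pn by blast
  from cong(2) obtain c' where c': "c = int p * c'"
    by (auto simp: cong_0_iff)
  from cong(1) obtain d' where "d - 1 = int p * d'"
    by (auto simp: cong_iff_dvd_diff)
  then have d': "d = 1 + int p * d'"
    by simp
  \<comment> \<open>The exponent of \<open>klein_shift\<close> at (0, j/p) for the translation by (j
    c', j d').\<close>
  define e :: "nat \<Rightarrow> complex" where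
    "e j = (of_int (int j * c' * (int j * d') + int j * c' + int j * d') - of_int (int j * c') * (of_nat j / of_nat p)) / 2" for j
  have shift: "klein 0 (of_nat j / of_nat p) \<tau>' = qexp (e j) * klein 0 (of_nat j / of_nat p) \<tau> / J" for j :: nat
  proof -
    have p0: "(of_nat p :: complex) \<noteq> 0"
      unfolding of_nat_eq_0_iff using p by simp
    have "0 * of_int a + of_nat j / of_nat p * of_int c = (0 + of_int (int j * c') :: complex)"
      using p0 by (simp add: c')
    moreover have "0 * of_int b + of_nat j / of_nat p * of_int d = (of_nat j / of_nat p + of_int (int j * d') :: complex)"
      using p0 by (simp add: d' distrib_left)
    ultimately have "klein 0 (of_nat j / of_nat p) \<tau>' =
        klein (0 + of_int (int j * c')) (of_nat j / of_nat p + of_int (int j * d')) \<tau> / J"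
      unfolding J_def \<tau>'_def klein_modular[OF det tau] by (simp only:)
    then show ?thesis
      unfolding klein_shift[OF tau] by (simp add: e_def)
  qed
  have "(\<Sum>j=1..n. e j) \<in> \<int>"
  proof -
    have "[int p ^ 2 = 1] (mod 24)"
      using prime_square_mod_24[OF p] cong_int_iff[of "p\<^sup>2" 1 24] by simp
    then have "24 dvd int p ^ 2 - 1"
      by (simp add: cong_iff_dvd_diff)
    then obtain N where "int p ^ 2 - 1 = 24 * N"
      by (elim dvdE)
    \<comment> \<open>With p = 2n + 1, p^2 - 1 = 4n(n + 1). Hence the sum of the j is 3N and that of
      their squares is Np.\<close>
    then have "int (n * (n + 1)) = 6 * N"
      by (simp add: pn power2_eq_square algebra_simps)
    then have "of_int (int (n * (n + 1))) = (of_int (6 * N) :: complex)"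
      by (rule arg_cong)
    then have N: "of_nat (n * (n + 1)) = (6 * of_int N :: complex)"
      by simp
    have S1: "(\<Sum>j=1..n. of_nat j) = (3 * of_int N :: complex)"
      unfolding sum_of_nat_closed N by simp
    have S2: "(\<Sum>j=1..n. of_nat j ^ 2) = (of_int N * of_nat p :: complex)"
      unfolding sum_of_nat_square_closed of_nat_mult[of "n * (n + 1)"] N by (simp add: pn)
    \<comment> \<open>As p is odd, this is d'(c' + 1) modulo 2. If d' is odd, then d is even, so c
      and with it c' must be odd.\<close>
    have "even (int p * c' * d' + 2 * c' + 3 * d')"
    proof -
      have "odd (a * d - b * c)"
        using det by simp
      then show ?thesis
        using \<open>odd p\<close> by (auto simp: c' d')
    qed
    then obtain M where "int p * c' * d' + 2 * c' + 3 * d' = 2 * M"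
      by (elim evenE)
    then have "of_int (int p * c' * d' + 2 * c' + 3 * d') = (of_int (2 * M) :: complex)"
      by (rule arg_cong)
    then have M: "of_nat p * of_int c' * of_int d' + 2 * of_int c' + 3 * of_int d' = (2 * of_int M :: complex)"
      by simp
    have "p \<noteq> 0"
      using p by auto
    have "(\<Sum>j=1..n. e j) = (\<Sum>j=1..n. of_nat j ^ 2 * ((of_int c' * of_int d' - of_int c' / of_nat p) / 2) +
        of_nat j * ((of_int c' + of_int d') / 2))"
      unfolding e_def using \<open>p \<noteq> 0\<close> by (intro sum.cong refl) (simp add: power2_eq_square field_simps)
    also have "\<dots> = of_int N * (of_nat p * of_int c' * of_int d' + 2 * of_int c' + 3 * of_int d') / 2"
      unfolding sum.distrib sum_distrib_right[symmetric] S1 S2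
      using \<open>p \<noteq> 0\<close> by (simp add: field_simps)
    also have "\<dots> = of_int (N * M)"
      unfolding M by simp
    finally show ?thesis
      by simp
  qed
  moreover have "(\<Prod>j\<in>A. qexp (e j)) = qexp (\<Sum>j\<in>A. e j)" if "finite A" for A
    using that by (induction rule: finite_induct) (auto simp: qexp_add)
  ultimately have qe: "(\<Prod>j=1..n. qexp (e j)) = 1"
    by (simp add: qexp_eq_1_iff)
  define L where "L \<sigma> = (\<Prod>j=1..n. klein 0 (of_nat j / of_nat p) \<sigma>)" for \<sigma>
  have L: "L \<sigma> * f \<sigma> = C" if "Im \<sigma> > 0" for \<sigma>
    using C(2)[OF that] by (simp add: L_def)
  have "L \<tau>' = (\<Prod>j=1..n. qexp (e j)) * L \<tau> / J ^ n"
    unfolding L_def shift by (simp add: prod.distrib prod_dividef)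
  then have "L \<tau> = L \<tau>' * J ^ n"
    unfolding qe using J by simp
  moreover have "L \<tau>' * f \<tau>' = L \<tau> * f \<tau>"
    using L[OF tau] L[OF tau'] by simp
  ultimately have "L \<tau>' * f \<tau>' = L \<tau>' * (J ^ n * f \<tau>)"
    by (simp only: mult.assoc)
  moreover have "L \<tau>' \<noteq> 0"
    using L[OF tau'] C(1) by auto
  ultimately have "f \<tau>' = J ^ n * f \<tau>"
    using mult_left_cancel by blast
  then show ?thesis
    unfolding J_def \<tau>'_def n_def .
qed

section \<open>Behaviour at the cusp at infinity\<close>

lemma open_upper_half_plane: "open upper_half_plane"
  unfolding upper_half_plane_def by (simp add: open_halfspace_Im_gt)

lemma connected_upper_half_plane: "connected upper_half_plane"
  unfolding upper_half_plane_def by (simp add: convex_connected convex_halfspace_Im_gt)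

text \<open>By periodicity F is a function of q_N on the punctured unit disc. Boundedness for large
  imaginary part makes 0 a removable singularity, and the Taylor series of the extension is the
  expansion.\<close>

lemma fourier_expansion_exists:
  assumes N: "N > 0" and holo: "F holomorphic_on upper_half_plane"
    and period: "\<And>z. z \<in> upper_half_plane \<Longrightarrow> F (z + of_nat N) = F z"
    and bound: "\<And>z. Im z \<ge> Y \<Longrightarrow> norm (F z) \<le> B"
  shows "\<exists>a. fourier_expansion N F a"
proof -
  have period': "F (z + of_int n * of_nat N) = F z" if "z \<in> upper_half_plane" for z n
    using int_period[of "on_uhp F" "of_nat N" z n] period that
    by (simp add: on_uhp_def upper_half_plane_def)
  define w where "w x = of_nat N * x / (2 * of_real pi * \<i>)" for x :: complex
  have w_inverse: "2 * of_real pi * \<i> * w x / of_nat N = x" for x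
    using N by (simp add: w_def)
  have Im_w: "Im (w x) = - (of_nat N * Re x / (2 * pi))" for x
    by (simp add: w_def Im_divide power2_eq_square)
  have w_uhp: "w x \<in> upper_half_plane" if "norm (exp x) < 1" for x
    using that N by (simp add: Im_w upper_half_plane_def divide_neg_pos mult_pos_neg)
  define G where "G x = F (w (Ln x))" for x
  \<comment> \<open>Two logarithms differ by a multiple of 2 pi i, which \<open>w\<close> turns into
    a multiple of the period N; the branch of \<open>Ln\<close> is therefore irrelevant.\<close>
  have F_w: "F (w y) = G (exp y)" if "norm (exp y) < 1" for y
  proof -
    have "exp (Ln (exp y)) = exp y"
      by simp
    then obtain n :: int where "Ln (exp y) = y + of_real (of_int (2 * n) * pi) * \<i>"
      unfolding exp_eq by blast
    then have "w (Ln (exp y)) = w y + of_int n * of_nat N"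
      by (simp add: w_def field_simps)
    with period'[OF w_uhp[OF that], of n] show ?thesis
      by (simp add: G_def)
  qed
  have "G holomorphic_on ball 0 1 - {0}"
  proof -
    have "\<exists>f'. (G has_field_derivative f') (at x)" if x: "x \<in> ball 0 1 - {0}" for x
    proof -
      \<comment> \<open>The principal branch is cut along the negative axis. Near \<open>x\<close>
        it is replaced by Ln(u/x) + Ln(x), which is holomorphic in u on \<open>U\<close>.\<close>
      define U where "U = (ball 0 1 - {0}) \<inter> {u. u / x \<notin> \<real>\<^sub>\<le>\<^sub>0}"
      have "open {u. u / x \<notin> \<real>\<^sub>\<le>\<^sub>0}"
      proof -
        have "open ((\<lambda>u. u / x) -` (- \<real>\<^sub>\<le>\<^sub>0))"
          using x by (intro open_vimage continuous_intros) auto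
        then show ?thesis
          by (simp add: vimage_def)
      qed
      then have "open U"
        unfolding U_def by (intro open_Int open_Diff) auto
      have "x \<in> U"
        using x by (auto simp: U_def)
      have exp_U: "exp (Ln (u / x) + Ln x) = u" if "u \<in> U" for u
        using that x by (auto simp: U_def exp_add)
      have "(\<lambda>u. w (Ln (u / x) + Ln x)) holomorphic_on U"
        unfolding w_def using x by (intro holomorphic_intros) (auto simp: U_def)
      moreover have "(\<lambda>u. w (Ln (u / x) + Ln x)) ` U \<subseteq> upper_half_plane"
        by (auto intro!: w_uhp simp: exp_U) (auto simp: U_def)
      ultimately have "F \<circ> (\<lambda>u. w (Ln (u / x) + Ln x)) holomorphic_on U"
        by (intro holomorphic_on_compose_gen[OF _ holo])
      then have "G holomorphic_on U"
      proof (rule holomorphic_transform)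
        fix u assume u: "u \<in> U"
        then have "norm (exp (Ln (u / x) + Ln x)) < 1"
          by (simp only: exp_U) (auto simp: U_def)
        from F_w[OF this] show "(F \<circ> (\<lambda>u. w (Ln (u / x) + Ln x))) u = G u"
          by (simp only: o_def exp_U[OF u])
      qed
      with \<open>open U\<close> \<open>x \<in> U\<close> show ?thesis
        by (auto simp: holomorphic_on_open)
    qed
    moreover have "open (ball 0 1 - {0 :: complex})"
      by (intro open_Diff) auto
    ultimately show ?thesis
      by (subst holomorphic_on_open) auto
  qed
  moreover have "eventually (\<lambda>x. norm (G x) \<le> B) (at 0)"
  proof -
    define r where "r = exp (- (2 * pi * Y / of_nat N))"
    have "norm (G x) \<le> B" if "x \<noteq> 0" "norm x < r" for x
    proof -
      have "ln (norm x) < - (2 * pi * Y / of_nat N)"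
        using that ln_less_cancel_iff[of "norm x" r] by (simp add: r_def)
      then have "Im (w (Ln x)) \<ge> Y"
        using that N by (simp add: Im_w field_simps)
      then show ?thesis
        unfolding G_def by (rule bound)
    qed
    moreover have "r > 0"
      by (simp add: r_def)
    ultimately show ?thesis
      by (auto simp: eventually_at intro!: exI[of _ r])
  qed
  ultimately obtain g where g: "g holomorphic_on ball 0 1" "\<And>x. x \<in> ball 0 1 - {0} \<Longrightarrow> g x = G x"
    using holomorphic_on_extend_bounded[of G "ball 0 1" 0] by auto
  have "fourier_expansion N F (\<lambda>n. (deriv ^^ n) g 0 / fact n)"
    unfolding fourier_expansion_def
  proof
    fix z assume z: "z \<in> upper_half_plane"
    define y where "y = 2 * of_real pi * \<i> * z / of_nat N"
    have "w y = z"
      using N by (simp add: w_def y_def)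
    have y: "norm (exp y) < 1"
      using z N by (simp add: y_def upper_half_plane_def)
    then have "(\<lambda>n. (deriv ^^ n) g 0 / fact n * (exp y - 0) ^ n) sums g (exp y)"
      by (intro holomorphic_power_series[OF g(1)]) auto
    moreover have "g (exp y) = F z"
      using g(2)[of "exp y"] F_w[OF y] y \<open>w y = z\<close> by simp
    ultimately show "(\<lambda>n. (deriv ^^ n) g 0 / fact n * exp (2 * of_real pi * \<i> * z / of_nat N) ^ n) sums F z"
      by (simp add: y_def)
  qed
  then show ?thesis
    by blast
qed

section \<open>Limits at i infinity and constant terms\<close>

abbreviation at_i_infinity :: "complex filter" where
  "at_i_infinity \<equiv> filtercomap Im at_top"

lemma eventually_at_i_infinity: "eventually P at_i_infinity \<longleftrightarrow> (\<exists>Y. \<forall>z. Im z \<ge> Y \<longrightarrow> P z)"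
  by (rule eventually_filtercomap_at_top_linorder)

lemma at_i_infinity_neq_bot [simp]: "at_i_infinity \<noteq> bot"
proof -
  have "Im (Complex 0 Y) \<ge> Y" for Y
    by simp
  then show ?thesis
    unfolding trivial_limit_def eventually_at_i_infinity by blast
qed

lemma eventually_uhp_at_i_infinity: "eventually (\<lambda>z. z \<in> upper_half_plane) at_i_infinity"
  unfolding eventually_at_i_infinity upper_half_plane_def by (intro exI[of _ 1]) auto

lemma tendsto_exp_at_i_infinity:
  assumes "\<alpha> > 0"
  shows "((\<lambda>z. exp (- (\<alpha> * Im z))) \<longlongrightarrow> 0) at_i_infinity"
proof -
  have "((\<lambda>y. exp (- (\<alpha> * y))) \<longlongrightarrow> 0) at_top"
    using assms by real_asymp
  then show ?thesis
    by (rule filterlim_compose) (rule filterlim_filtercomap)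
qed

lemma tendsto_qexp_at_i_infinity:
  assumes "\<alpha> > 0"
  shows "((\<lambda>z. qexp (of_real \<alpha> * z + of_real \<beta>)) \<longlongrightarrow> 0) at_i_infinity"
  using tendsto_exp_at_i_infinity[of "2 * pi * \<alpha>"] assms
  by (subst tendsto_norm_zero_iff[symmetric]) (simp add: norm_qexp mult.assoc)

text \<open>Every point of the punctured unit disc is q_N of a point of the upper half plane, so the
  power series converges on the disc and is continuous at 0.\<close>

lemma fourier_expansion_tendsto:
  assumes N: "N > 0" and "fourier_expansion N g a"
  shows "(g \<longlongrightarrow> a 0) at_i_infinity"
proof -
  define f where "f x = (\<Sum>n. a n * x ^ n)" for x
  have sums: "(\<lambda>n. a n * x ^ n) sums g z" if "z \<in> upper_half_plane" "qexp (z / of_nat N) = x" for x z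
    using assms(2) that by (auto simp: fourier_expansion_def qexp_def)
  have "(f \<longlongrightarrow> a 0) (at 0)"
  proof (rule powser_limit_0_strong[of 1])
    fix x :: complex assume x: "x \<noteq> 0" "norm x < 1"
    define z where "z = of_nat N * Ln x / (2 * of_real pi * \<i>)"
    have "qexp (z / of_nat N) = x"
      using x N by (simp add: z_def qexp_def)
    moreover have "Im z = - (of_nat N * ln (norm x) / (2 * pi))"
      using x by (simp add: z_def Im_divide power2_eq_square)
    then have "z \<in> upper_half_plane"
      using x N by (simp add: upper_half_plane_def divide_neg_pos mult_pos_neg)
    ultimately show "(\<lambda>n. a n * x ^ n) sums f x"
      unfolding f_def using sums sums_summable summable_sums by blast
  qed auto
  moreover have "filterlim (\<lambda>z. qexp (z / of_nat N)) (at 0) at_i_infinity"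
    using tendsto_qexp_at_i_infinity[of "1 / real N" 0] N by (auto simp: filterlim_at)
  ultimately have "((\<lambda>z. f (qexp (z / of_nat N))) \<longlongrightarrow> a 0) at_i_infinity"
    by (rule filterlim_compose)
  then show ?thesis
  proof (rule Lim_transform_eventually)
    show "eventually (\<lambda>z. f (qexp (z / of_nat N)) = g z) at_i_infinity"
      using eventually_uhp_at_i_infinity
      by eventually_elim (use sums in \<open>auto simp: f_def sums_iff\<close>)
  qed
qed

text \<open>For negative s, the function times its reciprocal would tend to 0, though it is 1. This
  turns the existence of a constant term into a sign condition on an order.\<close>

lemma exp_tendsto_at_i_infinity_iff:
  fixes s L :: real
  assumes "((\<lambda>z. exp (- (s * Im z))) \<longlongrightarrow> L) at_i_infinity"
  shows "s \<ge> 0" and "L \<noteq> 0 \<longleftrightarrow> s = 0"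
proof -
  show "s \<ge> 0"
  proof (rule ccontr)
    assume s: "\<not> s \<ge> 0"
    have "((\<lambda>z. exp (- (s * Im z)) * exp (- (- s * Im z))) \<longlongrightarrow> L * 0) at_i_infinity"
      using assms tendsto_exp_at_i_infinity[of "- s"] s by (intro tendsto_mult) auto
    then have "((\<lambda>z. 1 :: real) \<longlongrightarrow> 0) at_i_infinity"
      by (simp flip: exp_add)
    then show False
      by (simp add: tendsto_const_iff)
  qed
  then consider "s = 0" | "s > 0"
    by linarith
  then show "L \<noteq> 0 \<longleftrightarrow> s = 0"
  proof cases
    case 1
    with assms show ?thesis
      by (simp add: tendsto_const_iff)
  next
    case 2
    then have "L = 0"
      using tendsto_unique[OF at_i_infinity_neq_bot assms tendsto_exp_at_i_infinity] by simp
    with 2 show ?thesis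
      by simp
  qed
qed

lemma tendsto_qpoch_at_i_infinity:
  assumes "\<alpha> > 0"
  shows "((\<lambda>z. qpoch (qexp (of_real \<alpha> * z + of_real \<beta>)) (qexp (of_real \<alpha> * z + of_real \<beta>))) \<longlongrightarrow> 1) at_i_infinity"
proof -
  have "(\<lambda>q. qpoch q q) holomorphic_on ball 0 1"
    by (intro holomorphic_intros) auto
  then have "continuous_on (ball 0 1) (\<lambda>q. qpoch q q)"
    by (rule holomorphic_on_imp_continuous_on)
  then have "isCont (\<lambda>q. qpoch q q) 0"
    by (simp add: continuous_on_eq_continuous_at)
  then have "((\<lambda>z. qpoch (qexp (of_real \<alpha> * z + of_real \<beta>)) (qexp (of_real \<alpha> * z + of_real \<beta>))) \<longlongrightarrow> qpoch 0 0) at_i_infinity"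
    by (rule isCont_tendsto_compose) (rule tendsto_qexp_at_i_infinity[OF assms])
  then show ?thesis
    by simp
qed

lemma dedekind_eta_holomorphic:
  assumes "f holomorphic_on S" "open S" "\<And>z. z \<in> S \<Longrightarrow> Im (f z) > 0"
  shows "(\<lambda>z. dedekind_eta (f z)) holomorphic_on S"
  unfolding dedekind_eta_qexp using assms
  by (intro holomorphic_intros) (auto simp: norm_qexp_less_1)

text \<open>The infinite products tend to 1, so only the modulus of the leading power of q is left:
  2 pi / 24 = pi / 12 is the rate for a single eta, and the real shift \<open>\<beta>\<close> has no
  effect on it.\<close>

lemma norm_eta_at_i_infinity:
  fixes r s :: int and \<alpha> \<beta> :: real
  assumes "\<alpha> > 0"
  shows "((\<lambda>z. exp (pi / 12 * (r + \<alpha> * s) * Im z) *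
      (norm (dedekind_eta z) powi r * norm (dedekind_eta (of_real \<alpha> * z + of_real \<beta>)) powi s)) \<longlongrightarrow> 1) at_i_infinity"
proof -
  define P where "P \<alpha> \<beta> z = norm (qpoch (qexp (of_real \<alpha> * z + of_real \<beta>)) (qexp (of_real \<alpha> * z + of_real \<beta>)))"
    for \<alpha> \<beta> z
  have exp_powi: "exp (x :: real) powi n = exp (of_int n * x)" for x and n :: int
    by (metis exp_not_eq_zero exp_power_int mult.commute)
  have P: "(P \<alpha> \<beta> \<longlongrightarrow> 1) at_i_infinity" if "\<alpha> > 0" for \<alpha> \<beta>
    unfolding P_def using tendsto_norm[OF tendsto_qpoch_at_i_infinity[OF that]] by simp
  have "norm (dedekind_eta (of_real \<alpha> * z + of_real \<beta>)) powi s =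
      exp (- (pi / 12 * \<alpha> * s * Im z)) * P \<alpha> \<beta> z powi s" for \<alpha> \<beta> z and s :: int
    by (simp add: dedekind_eta_qexp P_def norm_mult norm_qexp power_int_mult_distrib exp_powi mult_ac)
  from this[of 1 _ 0 r] this[of \<alpha> _ \<beta> s]
  have "exp (pi / 12 * (r + \<alpha> * s) * Im z) *
      (norm (dedekind_eta z) powi r * norm (dedekind_eta (of_real \<alpha> * z + of_real \<beta>)) powi s) =
      P 1 0 z powi r * P \<alpha> \<beta> z powi s" for z
    by (simp add: algebra_simps add_divide_distrib exp_add exp_minus)
  moreover have "((\<lambda>z. P 1 0 z powi r * P \<alpha> \<beta> z powi s) \<longlongrightarrow> 1 powi r * 1 powi s) at_i_infinity"
    using assms by (intro tendsto_mult tendsto_power_int P) auto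
  ultimately show ?thesis
    by simp
qed

lemma uhp_iff: "z \<in> upper_half_plane \<longleftrightarrow> Im z > 0"
  by (simp add: upper_half_plane_def)

section \<open>The two eta quotients of weight (p - 1) / 2\<close>

text \<open>The modulus has a maximum at an interior point, so the maximum modulus principle
  applies.\<close>

lemma holomorphic_constant_norm:
  assumes "h holomorphic_on S" "open S" "connected S" "\<And>z. z \<in> S \<Longrightarrow> norm (h z) = C"
  obtains c where "\<And>z. z \<in> S \<Longrightarrow> h z = c"
proof (cases "S = {}")
  case False
  then obtain \<xi> where "\<xi> \<in> S"
    by auto
  then have "h constant_on S"
    using assms by (intro maximum_modulus_principle[of h S S \<xi>]) auto
  with that show ?thesis
    by (auto simp: constant_on_def)
qed (use that in auto)

lemma norm_eta_inversion:
  assumes "Im \<tau> > 0"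
  shows "norm (dedekind_eta (- 1 / \<tau>)) = sqrt (norm \<tau>) * norm (dedekind_eta \<tau>)"
  using norm_eta_modular[of 0 0 "- 1" 1 \<tau>] assms by simp

text \<open>The ratio \<open>h\<close> of the two sides without the constant is holomorphic and has
  constant modulus p^(p/2) by the absolute law for inversion. The surplus sqrt(|tau|)^(p - 1) is the
  modulus of tau^n.\<close>

lemma eta_quotient_Fricke:
  fixes p n :: nat
  assumes p: "p = 2 * n + 1"
  obtains c where "c \<noteq> 0"
    "\<And>\<tau>. Im \<tau> > 0 \<Longrightarrow> dedekind_eta (- 1 / (of_nat p * \<tau>)) ^ p / dedekind_eta (of_nat p * (- 1 / (of_nat p * \<tau>))) =
      c * \<tau> ^ n * (dedekind_eta (of_nat p * \<tau>) ^ p / dedekind_eta \<tau>)"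
proof -
  have p0: "p > 0"
    using p by simp
  define f g where "f \<tau> = dedekind_eta \<tau> ^ p / dedekind_eta (of_nat p * \<tau>)"
    and "g \<tau> = dedekind_eta (of_nat p * \<tau>) ^ p / dedekind_eta \<tau>" for \<tau>
  define h where "h \<tau> = f (- 1 / (of_nat p * \<tau>)) / (\<tau> ^ n * g \<tau>)" for \<tau>
  have Im_inv: "Im (1 / z) < 0" if "Im z > 0" for z
    using Im_modular_action_pos[of 0 0 "- 1" 1 z] that by simp
  have Im_p: "Im (of_nat p * z) > 0" if "Im z > 0" for z
    using that p0 by simp
  have cancel: "of_nat p * (- 1 / (of_nat p * \<tau>)) = - 1 / \<tau>" for \<tau> :: complex
    using p0 by simp
  have g0: "g \<tau> \<noteq> 0" if "Im \<tau> > 0" for \<tau>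
    using that Im_p by (simp add: g_def dedekind_eta_nonzero)
  have norm_h: "norm (h \<tau>) = sqrt p ^ p" if tau: "Im \<tau> > 0" for \<tau>
  proof -
    have "\<tau> \<noteq> 0"
      using tau by auto
    have "norm (f (- 1 / (of_nat p * \<tau>))) =
        (sqrt (norm (of_nat p * \<tau>)) * norm (dedekind_eta (of_nat p * \<tau>))) ^ p / (sqrt (norm \<tau>) * norm (dedekind_eta \<tau>))"
      unfolding f_def cancel norm_divide norm_power norm_eta_inversion[OF tau] norm_eta_inversion[OF Im_p[OF tau]] ..
    also have "\<dots> = sqrt p ^ p * sqrt (norm \<tau>) ^ p / sqrt (norm \<tau>) * norm (g \<tau>)"
      by (simp add: norm_mult real_sqrt_mult power_mult_distrib g_def norm_divide norm_power)
    also have "sqrt (norm \<tau>) ^ p / sqrt (norm \<tau>) = norm \<tau> ^ n"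
      unfolding p using \<open>\<tau> \<noteq> 0\<close> by (simp add: power_mult)
    then have "sqrt p ^ p * sqrt (norm \<tau>) ^ p / sqrt (norm \<tau>) * norm (g \<tau>) = sqrt p ^ p * norm \<tau> ^ n * norm (g \<tau>)"
      by (simp flip: times_divide_eq_right)
    finally show ?thesis
      using \<open>\<tau> \<noteq> 0\<close> g0[OF tau] by (simp add: h_def norm_divide norm_mult norm_power)
  qed
  have "h holomorphic_on upper_half_plane"
    unfolding h_def f_def g_def cancel using p0
    by (intro holomorphic_intros dedekind_eta_holomorphic open_upper_half_plane)
      (auto simp: uhp_iff dedekind_eta_nonzero Im_inv Im_p)
  then obtain c where c: "\<And>z. z \<in> upper_half_plane \<Longrightarrow> h z = c"
    using holomorphic_constant_norm[OF _ open_upper_half_plane connected_upper_half_plane, of h "sqrt p ^ p"] norm_h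
    by (auto simp: uhp_iff)
  show ?thesis
  proof (rule that)
    have "h \<i> = c"
      by (intro c) (simp add: uhp_iff)
    then have "norm c = sqrt p ^ p"
      using norm_h[of \<i>] by simp
    then show "c \<noteq> 0"
      using p0 by auto
  next
    fix \<tau> :: complex assume tau: "Im \<tau> > 0"
    then have "\<tau> \<noteq> 0"
      by auto
    have "f (- 1 / (of_nat p * \<tau>)) = c * (\<tau> ^ n * g \<tau>)"
      using c[of \<tau>] tau g0[OF tau] \<open>\<tau> \<noteq> 0\<close> by (simp add: uhp_iff h_def divide_eq_eq)
    then show "dedekind_eta (- 1 / (of_nat p * \<tau>)) ^ p / dedekind_eta (of_nat p * (- 1 / (of_nat p * \<tau>))) =
      c * \<tau> ^ n * (dedekind_eta (of_nat p * \<tau>) ^ p / dedekind_eta \<tau>)"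
      by (simp only: f_def g_def mult.assoc)
  qed
qed

text \<open>The involution tau -> -1/(p tau) conjugates the given matrix to the one with rows (d,
  -c') and (-pb, a), which lies in Gamma1(p) again. The law for \<open>f\<close> at
  \<open>\<sigma>\<close> thus becomes the law for \<open>g\<close> at tau.\<close>

lemma eta_quotient_Gamma1_Fricke:
  fixes a b c d :: int and p :: nat
  assumes p: "prime p" "p > 3"
    and det: "a * d - b * c = 1" and tau: "Im \<tau> > 0"
    and cong: "[d = 1] (mod int p)" "[c = 0] (mod int p)" "[a = 1] (mod int p)"
  defines "g \<equiv> \<lambda>\<tau>. dedekind_eta (of_nat p * \<tau>) ^ p / dedekind_eta \<tau>"
  shows "g ((of_int a * \<tau> + of_int b) / (of_int c * \<tau> + of_int d)) =
      (of_int c * \<tau> + of_int d) ^ ((p - 1) div 2) * g \<tau>"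
proof -
  define n where "n = (p - 1) div 2"
  have "odd p"
    using p prime_odd_nat by auto
  then have pn: "p = 2 * n + 1"
    by (auto simp: n_def elim!: oddE)
  define J \<tau>' where "J = of_int c * \<tau> + of_int d" and "\<tau>' = (of_int a * \<tau> + of_int b) / J"
  have J: "J \<noteq> 0" and tau': "Im \<tau>' > 0"
    using J_nonzero[OF det tau] Im_modular_action_pos[OF det tau] by (simp_all add: J_def \<tau>'_def)
  have "\<tau> \<noteq> 0" "\<tau>' \<noteq> 0"
    using tau tau' by auto
  have p0: "(of_nat p :: complex) \<noteq> 0"
    unfolding of_nat_eq_0_iff using p by simp
  define f where "f \<tau> = dedekind_eta \<tau> ^ p / dedekind_eta (of_nat p * \<tau>)" for \<tau>
  obtain k where k: "k \<noteq> 0" "\<And>\<tau>. Im \<tau> > 0 \<Longrightarrow> f (- 1 / (of_nat p * \<tau>)) = k * \<tau> ^ n * g \<tau>"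
    using eta_quotient_Fricke[OF pn] unfolding f_def g_def by blast
  from cong(2) obtain c' where c': "c = int p * c'"
    by (auto simp: cong_0_iff)
  define \<sigma> where "\<sigma> = - 1 / (of_nat p * \<tau>)"
  have "Im \<sigma> > 0"
  proof -
    have "Im (- 1 / z) > 0" if "Im z > 0" for z
      using Im_modular_action_pos[of 0 0 "- 1" 1 z] that by simp
    then show ?thesis
      using tau p unfolding \<sigma>_def by simp
  qed
  define B where "B = of_int a * \<tau> + of_int b"
  have B: "B = \<tau>' * J"
    using J by (simp add: \<tau>'_def B_def)
  then have "B \<noteq> 0"
    using \<open>\<tau>' \<noteq> 0\<close> J by simp
  have den: "of_int (- (int p * b)) * \<sigma> + of_int a = B / \<tau>"
    using p0 \<open>\<tau> \<noteq> 0\<close> by (simp add: \<sigma>_def B_def add_divide_distrib)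
  have num: "of_int d * \<sigma> + of_int (- c') = - J / (of_nat p * \<tau>)"
    using p0 \<open>\<tau> \<noteq> 0\<close> by (simp add: \<sigma>_def J_def c' field_simps)
  have "f ((of_int d * \<sigma> + of_int (- c')) / (of_int (- (int p * b)) * \<sigma> + of_int a)) =
      (of_int (- (int p * b)) * \<sigma> + of_int a) ^ ((p - 1) div 2) * f \<sigma>"
    unfolding f_def
  proof (rule eta_quotient_Gamma1[OF p])
    show "d * a - - c' * - (int p * b) = 1"
      using det by (simp add: c' mult_ac)
    show "[- (int p * b) = 0] (mod int p)"
      by (simp add: cong_0_iff)
  qed (use cong \<open>Im \<sigma> > 0\<close> in auto)
  also have "(of_int d * \<sigma> + of_int (- c')) / (of_int (- (int p * b)) * \<sigma> + of_int a) = - 1 / (of_nat p * \<tau>')"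
    unfolding num den B using J p0 \<open>\<tau> \<noteq> 0\<close> \<open>\<tau>' \<noteq> 0\<close> by (simp add: field_simps)
  also have "f \<dots> = k * \<tau>' ^ n * g \<tau>'"
    by (rule k(2)[OF tau'])
  also have "f \<sigma> = k * \<tau> ^ n * g \<tau>"
    unfolding \<sigma>_def by (rule k(2)[OF tau])
  also have "(of_int (- (int p * b)) * \<sigma> + of_int a) ^ ((p - 1) div 2) = (\<tau>' * J) ^ n / \<tau> ^ n"
    unfolding den B n_def[symmetric] by (simp add: power_divide)
  finally have "g \<tau>' = J ^ n * g \<tau>"
    using k(1) \<open>\<tau> \<noteq> 0\<close> \<open>\<tau>' \<noteq> 0\<close> by (simp add: power_mult_distrib)
  then show ?thesis
    unfolding J_def \<tau>'_def n_def .
qed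

section \<open>Eta quotients as modular forms\<close>

definition eta_quotient :: "nat \<Rightarrow> int \<Rightarrow> int \<Rightarrow> complex \<Rightarrow> complex" where
  "eta_quotient p r s = on_uhp (\<lambda>z. dedekind_eta z powi r * dedekind_eta (of_nat p * z) powi s)"

lemma eta_quotients_eq: "eta_quotients p = {eta_quotient p r s | r s. True}"
  by (auto simp: eta_quotients_def eta_quotient_def)

definition automorphy :: "int^2^2 \<Rightarrow> complex \<Rightarrow> complex" where
  "automorphy A z = of_int (A $ 2 $ 1) * z + of_int (A $ 2 $ 2)"

lemma SL2Z_det: "A \<in> SL2Z \<longleftrightarrow> A $ 1 $ 1 * A $ 2 $ 2 - A $ 1 $ 2 * A $ 2 $ 1 = 1"
  by (simp add: SL2Z_def det_2)

lemma automorphy_nonzero: "A \<in> SL2Z \<Longrightarrow> z \<in> upper_half_plane \<Longrightarrow> automorphy A z \<noteq> 0"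
  unfolding SL2Z_det automorphy_def uhp_iff by (rule J_nonzero)

lemma moebius_uhp: "A \<in> SL2Z \<Longrightarrow> z \<in> upper_half_plane \<Longrightarrow> moebius A z \<in> upper_half_plane"
  unfolding SL2Z_det moebius_def uhp_iff by (rule Im_modular_action_pos)

lemma eta_quotient_nonzero: "p > 0 \<Longrightarrow> z \<in> upper_half_plane \<Longrightarrow> eta_quotient p r s z \<noteq> 0"
  by (simp add: eta_quotient_def on_uhp_def uhp_iff dedekind_eta_nonzero)

lemma eta_quotient_holomorphic: "p > 0 \<Longrightarrow> eta_quotient p r s holomorphic_on upper_half_plane"
proof -
  assume "p > 0"
  then have "(\<lambda>z. dedekind_eta z powi r * dedekind_eta (of_nat p * z) powi s) holomorphic_on upper_half_plane"
    by (intro holomorphic_intros dedekind_eta_holomorphic open_upper_half_plane)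
      (auto simp: uhp_iff dedekind_eta_nonzero)
  then show ?thesis
    by (rule holomorphic_transform) (simp add: eta_quotient_def on_uhp_def)
qed

text \<open>If p divides c, then pAz = A'(pz) with A' in SL2(Z). Otherwise diag(p, 1) A = A' B,
  where B has rows (1, beta), (0, p) and A' has rows (pa, b - a beta), (c, e); then pAz = A'w with w
  = (z + beta) / p. The explicit \<open>D\<close> and \<open>\<beta>\<close> of the first case serve
  to determine the weight.\<close>

lemma norm_eta_level:
  fixes A :: "int^2^2"
  assumes p: "prime p" and A: "A \<in> SL2Z"
  obtains D \<alpha> \<beta> :: real where "D > 0" "\<alpha> = (if int p dvd A $ 2 $ 1 then real p else 1 / real p)"
    "\<And>z. z \<in> upper_half_plane \<Longrightarrow> norm (dedekind_eta (of_nat p * moebius A z)) =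
      sqrt (norm (automorphy A z)) * D * norm (dedekind_eta (of_real \<alpha> * z + of_real \<beta>))"
    "int p dvd A $ 2 $ 1 \<Longrightarrow> D = 1 \<and> \<beta> = 0"
proof -
  define a b c d where "a = A $ 1 $ 1" and "b = A $ 1 $ 2" and "c = A $ 2 $ 1" and "d = A $ 2 $ 2"
  have det: "a * d - b * c = 1"
    using A by (simp add: SL2Z_det a_def b_def c_def d_def)
  have p0: "p > 0"
    using p by (simp add: prime_gt_0_nat)
  have J0: "automorphy A z \<noteq> 0" if "z \<in> upper_half_plane" for z
    using automorphy_nonzero[OF A that] .
  have J: "automorphy A z = of_int c * z + of_int d" for z
    by (simp add: automorphy_def c_def d_def)
  have M: "moebius A z = (of_int a * z + of_int b) / automorphy A z" for z
    by (simp add: moebius_def J a_def b_def c_def d_def)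
  show ?thesis
  proof (cases "int p dvd c")
    case True
    then obtain c' where c': "c = int p * c'"
      by (elim dvdE)
    show ?thesis
    proof (rule that[of 1 "real p" 0])
      fix z assume z: "z \<in> upper_half_plane"
      have "norm (dedekind_eta ((of_int a * (of_nat p * z) + of_int (int p * b)) / (of_int c' * (of_nat p * z) + of_int d))) =
          sqrt (norm (of_int c' * (of_nat p * z) + of_int d)) * norm (dedekind_eta (of_nat p * z))"
        by (rule norm_eta_modular) (use det z p0 in \<open>auto simp: c' uhp_iff mult_ac\<close>)
      moreover have "of_int c' * (of_nat p * z) + of_int d = automorphy A z"
        by (simp add: J c')
      moreover have "(of_int a * (of_nat p * z) + of_int (int p * b)) / automorphy A z = of_nat p * moebius A z"
        by (simp add: M algebra_simps)
      ultimately show "norm (dedekind_eta (of_nat p * moebius A z)) =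
          sqrt (norm (automorphy A z)) * 1 * norm (dedekind_eta (of_real (real p) * z + of_real 0))"
        by simp
    qed (use True in \<open>auto simp: c_def\<close>)
  next
    case False
    then have "coprime c (int p)"
      using p prime_imp_coprime[of "int p" c] by (simp add: coprime_commute)
    then obtain x where "[c * x = 1] (mod int p)"
      using cong_solve_coprime_int by blast
    then have "[c * x * d = 1 * d] (mod int p)"
      by (rule cong_scalar_right)
    \<comment> \<open>The solution of c beta = d modulo p; it makes the lower right entry e of A'
      integral.\<close>
    define \<beta> where "\<beta> = x * d"
    have "int p dvd d - c * \<beta>"
      using \<open>[c * x * d = 1 * d] (mod int p)\<close> by (simp add: cong_iff_dvd_diff dvd_diff_commute \<beta>_def mult_ac)
    then obtain e where e: "d - c * \<beta> = int p * e"
      by (elim dvdE)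
    show ?thesis
    \<comment> \<open>The automorphy factor of A at z is p times that of A' at w, hence the constant
      p^(-1/2).\<close>
    proof (rule that[of "sqrt (1 / real p)" "1 / real p" "of_int \<beta> / real p"])
      fix z assume z: "z \<in> upper_half_plane"
      define w where "w = (z + of_int \<beta>) / of_nat p"
      have w: "of_nat p * w = z + of_int \<beta>"
        using p0 by (simp add: w_def)
      have "of_int d - of_int c * of_int \<beta> = (of_nat p * of_int e :: complex)"
        using arg_cong[OF e, of "of_int :: int \<Rightarrow> complex"] by simp
      note pe = this[symmetric]
      have "of_nat p * (of_int c * w + of_int e) = of_int c * (of_nat p * w) + of_nat p * of_int e"
        by (simp add: algebra_simps)
      then have den: "automorphy A z = of_nat p * (of_int c * w + of_int e)"
        unfolding w pe by (simp add: J algebra_simps)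
      have "of_int (int p * a) * w + of_int (b - a * \<beta>) = of_int a * (of_nat p * w) + of_int (b - a * \<beta>)"
        by simp
      then have num: "of_int a * z + of_int b = of_int (int p * a) * w + of_int (b - a * \<beta>)"
        unfolding w by (simp add: algebra_simps)
      have "norm (dedekind_eta ((of_int (int p * a) * w + of_int (b - a * \<beta>)) / (of_int c * w + of_int e))) =
          sqrt (norm (of_int c * w + of_int e)) * norm (dedekind_eta w)"
      proof (rule norm_eta_modular)
        have "(int p * a) * e - (b - a * \<beta>) * c = a * (int p * e + c * \<beta>) - b * c"
          by (simp add: algebra_simps)
        also have "int p * e + c * \<beta> = d"
          using e by simp
        finally show "(int p * a) * e - (b - a * \<beta>) * c = 1"
          using det by simp
        show "Im w > 0"
          using z p0 by (simp add: w_def uhp_iff)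
      qed
      moreover have "(of_int (int p * a) * w + of_int (b - a * \<beta>)) / (of_int c * w + of_int e) = of_nat p * moebius A z"
        unfolding M den num using p0 by simp
      moreover have "sqrt (norm (of_int c * w + of_int e)) = sqrt (norm (automorphy A z)) * sqrt (1 / real p)"
        using p0 by (simp add: den norm_mult flip: real_sqrt_mult)
      moreover have "w = of_real (1 / real p) * z + of_real (of_int \<beta> / real p)"
        by (simp add: w_def add_divide_distrib)
      ultimately show "norm (dedekind_eta (of_nat p * moebius A z)) = sqrt (norm (automorphy A z)) * sqrt (1 / real p) *
          norm (dedekind_eta (of_real (1 / real p) * z + of_real (of_int \<beta> / real p)))"
        by simp
    qed (use False p0 in \<open>auto simp: c_def\<close>)
  qed
qed

text \<open>The power of the automorphy factor isolates the discrepancy between the weight k of the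
  slash operator and the weight (r + s)/2 of the quotient.\<close>

lemma norm_slash_eta_quotient:
  fixes A :: "int^2^2"
  assumes p: "prime p" and A: "A \<in> SL2Z"
  obtains C \<alpha> \<beta> :: real where "C > 0" "\<alpha> = (if int p dvd A $ 2 $ 1 then real p else 1 / real p)"
    "\<And>z. z \<in> upper_half_plane \<Longrightarrow> norm (slash k A (eta_quotient p r s) z) =
      sqrt (norm (automorphy A z)) powi (r + s - 2 * k) *
      (C * (norm (dedekind_eta z) powi r * norm (dedekind_eta (of_real \<alpha> * z + of_real \<beta>)) powi s))"
    "int p dvd A $ 2 $ 1 \<Longrightarrow> C = 1 \<and> \<beta> = 0"
proof -
  obtain D \<alpha> \<beta> :: real where D: "D > 0" "\<alpha> = (if int p dvd A $ 2 $ 1 then real p else 1 / real p)"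
    "\<And>z. z \<in> upper_half_plane \<Longrightarrow> norm (dedekind_eta (of_nat p * moebius A z)) =
      sqrt (norm (automorphy A z)) * D * norm (dedekind_eta (of_real \<alpha> * z + of_real \<beta>))"
    "int p dvd A $ 2 $ 1 \<Longrightarrow> D = 1 \<and> \<beta> = 0"
    using norm_eta_level[OF p A] by metis
  show ?thesis
  proof (rule that[of "D powi s" \<alpha> \<beta>])
    fix z assume z: "z \<in> upper_half_plane"
    define j where "j = sqrt (norm (automorphy A z))"
    have j: "j \<noteq> 0"
      using automorphy_nonzero[OF A z] by (simp add: j_def)
    have eta: "norm (dedekind_eta (moebius A z)) = j * norm (dedekind_eta z)"
      unfolding moebius_def j_def automorphy_def
      by (rule norm_eta_modular) (use A z in \<open>auto simp: SL2Z_det uhp_iff\<close>)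
    have eta_p: "norm (dedekind_eta (of_nat p * moebius A z)) = j * D * norm (dedekind_eta (of_real \<alpha> * z + of_real \<beta>))"
      unfolding j_def by (rule D(3)[OF z])
    have j2: "norm (automorphy A z) = j powi 2"
      by (simp add: j_def)
    have "norm (slash k A (eta_quotient p r s) z) =
        norm (automorphy A z) powi (- k) * (norm (dedekind_eta (moebius A z)) powi r * norm (dedekind_eta (of_nat p * moebius A z)) powi s)"
      using moebius_uhp[OF A z]
      by (simp add: slash_def eta_quotient_def on_uhp_def norm_mult norm_power_int flip: automorphy_def)
    also have "norm (automorphy A z) powi (- k) = j powi (- 2 * k)"
      unfolding j2 power_int_mult[symmetric] by simp
    also have "j powi (- 2 * k) * (norm (dedekind_eta (moebius A z)) powi r * norm (dedekind_eta (of_nat p * moebius A z)) powi s) =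
        (j powi (- 2 * k) * j powi r * j powi s) *
        (D powi s * (norm (dedekind_eta z) powi r * norm (dedekind_eta (of_real \<alpha> * z + of_real \<beta>)) powi s))"
      unfolding eta eta_p power_int_mult_distrib by (simp only: mult_ac)
    also have "j powi (- 2 * k) * j powi r * j powi s = j powi (r + s - 2 * k)"
      using j by (simp flip: power_int_add) (simp add: algebra_simps)
    finally show "norm (slash k A (eta_quotient p r s) z) =
      sqrt (norm (automorphy A z)) powi (r + s - 2 * k) *
      (D powi s * (norm (dedekind_eta z) powi r * norm (dedekind_eta (of_real \<alpha> * z + of_real \<beta>)) powi s))"
      by (simp add: j_def)
  qed (use D in auto)
qed

lemma norm_slash_eta_quotient_tendsto:
  fixes A :: "int^2^2"
  assumes p: "prime p" and A: "A \<in> SL2Z" and k: "r + s = 2 * k"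
  defines "e \<equiv> pi / 12 * (r + (if int p dvd A $ 2 $ 1 then real p else 1 / real p) * s)"
  obtains C where "C > 0" "((\<lambda>z. exp (e * Im z) * norm (slash k A (eta_quotient p r s) z)) \<longlongrightarrow> C) at_i_infinity"
proof -
  obtain C \<alpha> \<beta> :: real where C: "C > 0" "\<alpha> = (if int p dvd A $ 2 $ 1 then real p else 1 / real p)"
    "\<And>z. z \<in> upper_half_plane \<Longrightarrow> norm (slash k A (eta_quotient p r s) z) =
      sqrt (norm (automorphy A z)) powi (r + s - 2 * k) *
      (C * (norm (dedekind_eta z) powi r * norm (dedekind_eta (of_real \<alpha> * z + of_real \<beta>)) powi s))"
    using norm_slash_eta_quotient[OF p A] by metis
  have "\<alpha> > 0"
    using C(2) p by (simp add: prime_gt_0_nat)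
  from tendsto_mult_left[OF norm_eta_at_i_infinity[OF this, of r s \<beta>], of C]
  have "((\<lambda>z. C * (exp (e * Im z) * (norm (dedekind_eta z) powi r * norm (dedekind_eta (of_real \<alpha> * z + of_real \<beta>)) powi s))) \<longlongrightarrow> C) at_i_infinity"
    by (simp add: e_def C(2))
  then have "((\<lambda>z. exp (e * Im z) * norm (slash k A (eta_quotient p r s) z)) \<longlongrightarrow> C) at_i_infinity"
  proof (rule Lim_transform_eventually)
    show "\<forall>\<^sub>F z in at_i_infinity.
      C * (exp (e * Im z) * (norm (dedekind_eta z) powi r * norm (dedekind_eta (of_real \<alpha> * z + of_real \<beta>)) powi s)) =
      exp (e * Im z) * norm (slash k A (eta_quotient p r s) z)"
      using eventually_uhp_at_i_infinity by eventually_elim (simp add: C(3) k)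
  qed
  with C(1) show ?thesis
    by (rule that)
qed

text \<open>|F| tends to |a 0|, while |F| times the exponential of the order tends to a positive
  constant; the quotient of the two is a pure exponential with a finite limit.\<close>

lemma eta_quotient_order:
  fixes A :: "int^2^2" and r s :: int
  assumes p: "prime p" and A: "A \<in> SL2Z" and k: "r + s = 2 * k"
    and a: "fourier_expansion p (slash k A (eta_quotient p r s)) a"
  defines "ord \<equiv> r + (if int p dvd A $ 2 $ 1 then real p else 1 / real p) * s"
  shows "ord \<ge> 0" and "a 0 \<noteq> 0 \<longleftrightarrow> ord = 0"
proof -
  define F where "F = slash k A (eta_quotient p r s)"
  obtain C where C: "C > 0" "((\<lambda>z. exp (pi / 12 * ord * Im z) * norm (F z)) \<longlongrightarrow> C) at_i_infinity"
    using norm_slash_eta_quotient_tendsto[OF p A k] unfolding F_def ord_def by metis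
  have p0: "p > 0"
    using p by (simp add: prime_gt_0_nat)
  have "((\<lambda>z. norm (F z)) \<longlongrightarrow> norm (a 0)) at_i_infinity"
    unfolding F_def by (intro tendsto_norm fourier_expansion_tendsto[OF p0 a])
  then have "((\<lambda>z. norm (F z) / (exp (pi / 12 * ord * Im z) * norm (F z))) \<longlongrightarrow> norm (a 0) / C) at_i_infinity"
    using C by (intro tendsto_divide) auto
  then have "((\<lambda>z. exp (- (pi / 12 * ord * Im z))) \<longlongrightarrow> norm (a 0) / C) at_i_infinity"
  proof (rule Lim_transform_eventually)
    have nz: "F z \<noteq> 0" if "z \<in> upper_half_plane" for z
      using automorphy_nonzero[OF A that] eta_quotient_nonzero[OF p0 moebius_uhp[OF A that]]
      by (simp add: F_def slash_def automorphy_def)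
    show "\<forall>\<^sub>F z in at_i_infinity. norm (F z) / (exp (pi / 12 * ord * Im z) * norm (F z)) = exp (- (pi / 12 * ord * Im z))"
      using eventually_uhp_at_i_infinity by eventually_elim (simp add: nz exp_minus field_simps)
  qed
  from exp_tendsto_at_i_infinity_iff[OF this] C(1) show "ord \<ge> 0" "a 0 \<noteq> 0 \<longleftrightarrow> ord = 0"
    using pi_gt_zero by (auto simp: zero_le_mult_iff not_le)
qed

lemma slash_periodic:
  fixes A :: "int^2^2"
  assumes A: "A \<in> SL2Z" and z: "z \<in> upper_half_plane"
    and inv: "\<And>M z. M \<in> Gamma1 N \<Longrightarrow> z \<in> upper_half_plane \<Longrightarrow> slash k M F z = F z"
  shows "slash k A F (z + of_nat N) = slash k A F z"
proof -
  define a b c d where "a = A $ 1 $ 1" and "b = A $ 1 $ 2" and "c = A $ 2 $ 1" and "d = A $ 2 $ 2"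
  have det: "a * d - b * c = 1"
    using A by (simp add: SL2Z_det a_def b_def c_def d_def)
  have det': "of_int a * of_int d - of_int b * of_int c = (1 :: complex)"
    by (rule det_complex[OF det])
  \<comment> \<open>conjugate by \<open>A\<close> of the translation by \<open>N\<close>\<close>
  define M :: "int^2^2" where
    "M = vector [vector [1 - int N * (a * c), int N * a\<^sup>2], vector [- (int N * c\<^sup>2), 1 + int N * (a * c)]]"
  have entries: "M $ 1 $ 1 = 1 - int N * (a * c)" "M $ 1 $ 2 = int N * a\<^sup>2"
    "M $ 2 $ 1 = - (int N * c\<^sup>2)" "M $ 2 $ 2 = 1 + int N * (a * c)"
    by (simp_all add: M_def)
  have "M \<in> Gamma1 N"
    by (auto simp: Gamma1_def SL2Z_det entries cong_iff_dvd_diff power2_eq_square algebra_simps)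
  define J J' where "J = of_int c * z + of_int d" and "J' = of_int c * (z + of_nat N) + of_int d"
  have J: "J \<noteq> 0" "J' \<noteq> 0"
    using automorphy_nonzero[OF A z] automorphy_nonzero[OF A, of "z + of_nat N"] z
    by (simp_all add: J_def J'_def automorphy_def c_def d_def uhp_iff)
  define w where "w = moebius A z"
  have w: "w = (of_int a * z + of_int b) / J"
    by (simp add: w_def moebius_def J_def a_def b_def c_def d_def)
  have "w \<in> upper_half_plane"
    unfolding w_def by (rule moebius_uhp[OF A z])
  have den: "(of_int (- (int N * c\<^sup>2)) * w + of_int (1 + int N * (a * c))) * J = J'"
  proof -
    have "(of_int (- (int N * c\<^sup>2)) * w + of_int (1 + int N * (a * c))) * J =
        - (of_nat N * of_int c ^ 2 * (of_int a * z + of_int b)) + (1 + of_nat N * of_int a * of_int c) * J"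
      using J by (simp add: w field_simps)
    also have "\<dots> = J + of_nat N * of_int c * (of_int a * of_int d - of_int b * of_int c)"
      by (simp add: J_def power2_eq_square algebra_simps)
    finally show ?thesis
      by (simp add: det' J_def J'_def algebra_simps)
  qed
  have num: "(of_int (1 - int N * (a * c)) * w + of_int (int N * a\<^sup>2)) * J = of_int a * (z + of_nat N) + of_int b"
  proof -
    have "(of_int (1 - int N * (a * c)) * w + of_int (int N * a\<^sup>2)) * J =
        (1 - of_nat N * of_int a * of_int c) * (of_int a * z + of_int b) + of_nat N * of_int a ^ 2 * J"
      using J by (simp add: w field_simps)
    also have "\<dots> = of_int a * z + of_int b + of_nat N * of_int a * (of_int a * of_int d - of_int b * of_int c)"
      by (simp add: J_def power2_eq_square algebra_simps)
    finally show ?thesis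
      by (simp add: det' algebra_simps)
  qed
  have M_w: "moebius M w = moebius A (z + of_nat N)"
  proof -
    have "moebius M w = ((of_int (1 - int N * (a * c)) * w + of_int (int N * a\<^sup>2)) * J) /
        ((of_int (- (int N * c\<^sup>2)) * w + of_int (1 + int N * (a * c))) * J)"
      unfolding moebius_def entries using J by simp
    also have "\<dots> = moebius A (z + of_nat N)"
      unfolding num den by (simp add: moebius_def J'_def a_def b_def c_def d_def)
    finally show ?thesis .
  qed
  have aut: "automorphy M w = J' / J"
    unfolding automorphy_def entries using den J by (simp add: eq_divide_eq)
  have "slash k A F z = J powi (- k) * F w"
    by (simp add: slash_def J_def c_def d_def w_def)
  also have "F w = (J' / J) powi (- k) * F (moebius A (z + of_nat N))"
    using inv[OF \<open>M \<in> Gamma1 N\<close> \<open>w \<in> upper_half_plane\<close>]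
    unfolding slash_def automorphy_def[symmetric] aut M_w by simp
  also have "J powi (- k) * \<dots> = (J * (J' / J)) powi (- k) * F (moebius A (z + of_nat N))"
    by (simp only: power_int_mult_distrib mult.assoc)
  also have "J * (J' / J) = J'"
    using J by simp
  also have "J' powi (- k) * F (moebius A (z + of_nat N)) = slash k A F (z + of_nat N)"
    by (simp add: slash_def J'_def c_def d_def)
  finally show ?thesis ..
qed

text \<open>A nonnegative order bounds the slashed function for large imaginary part, and with the
  invariance under Gamma1(p) this yields the expansion at every cusp.\<close>

lemma eta_quotient_modular_form:
  assumes p: "prime p" and k: "r + s = 2 * k"
    and ord: "r + int p * s \<ge> 0" "int p * r + s \<ge> 0"
    and inv: "\<And>M z. M \<in> Gamma1 p \<Longrightarrow> z \<in> upper_half_plane \<Longrightarrow>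
      slash k M (eta_quotient p r s) z = eta_quotient p r s z"
  shows "eta_quotient p r s \<in> modular_forms k p"
proof -
  define F where "F = eta_quotient p r s"
  have p0: "p > 0"
    using p by (simp add: prime_gt_0_nat)
  have "\<exists>a. fourier_expansion p (slash k A F) a" if A: "A \<in> SL2Z" for A
  proof -
    define e where "e = pi / 12 * (r + (if int p dvd A $ 2 $ 1 then real p else 1 / real p) * s)"
    have "e \<ge> 0"
    proof -
      have "real_of_int (r + int p * s) \<ge> 0" "real_of_int (int p * r + s) \<ge> 0"
        using ord by (simp_all only: of_int_0_le_iff)
      then have "r + (if int p dvd A $ 2 $ 1 then real p else 1 / real p) * s \<ge> 0"
        using p0 by (auto simp: field_simps)
      then show ?thesis
        unfolding e_def by (intro mult_nonneg_nonneg) auto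
    qed
    obtain C where "((\<lambda>z. exp (e * Im z) * norm (slash k A F z)) \<longlongrightarrow> C) at_i_infinity"
      using norm_slash_eta_quotient_tendsto[OF p A k] unfolding F_def e_def by metis
    then have "\<forall>\<^sub>F z in at_i_infinity. exp (e * Im z) * norm (slash k A F z) < C + 1"
      by (rule order_tendstoD) simp
    then have "\<forall>\<^sub>F z in at_i_infinity. norm (slash k A F z) \<le> C + 1"
      using eventually_uhp_at_i_infinity
    proof eventually_elim
      case (elim z)
      have "1 * norm (slash k A F z) \<le> exp (e * Im z) * norm (slash k A F z)"
        using elim \<open>e \<ge> 0\<close> by (intro mult_right_mono) (auto simp: uhp_iff)
      with elim show ?case
        by simp
    qed
    then obtain Y where Y: "\<And>z. Im z \<ge> Y \<Longrightarrow> norm (slash k A F z) \<le> C + 1"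
      unfolding eventually_at_i_infinity by blast
    show ?thesis
    proof (rule fourier_expansion_exists[OF p0 _ _ Y])
      have "(\<lambda>z. automorphy A z) holomorphic_on upper_half_plane"
        unfolding automorphy_def by (intro holomorphic_intros)
      moreover have "moebius A holomorphic_on upper_half_plane"
        unfolding moebius_def using automorphy_nonzero[OF A]
        by (intro holomorphic_intros) (auto simp: automorphy_def)
      then have "(F \<circ> moebius A) holomorphic_on upper_half_plane"
        using moebius_uhp[OF A] eta_quotient_holomorphic[OF p0] unfolding F_def
        by (intro holomorphic_on_compose_gen) auto
      moreover from calculation(1) have "(\<lambda>z. automorphy A z powi (- k)) holomorphic_on upper_half_plane"
        using automorphy_nonzero[OF A] by (intro holomorphic_on_power_int) auto
      ultimately have "(\<lambda>z. automorphy A z powi (- k) * (F \<circ> moebius A) z) holomorphic_on upper_half_plane"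
        by (intro holomorphic_on_mult)
      then show "slash k A F holomorphic_on upper_half_plane"
        by (simp add: slash_def[abs_def] automorphy_def o_def)
      show "slash k A F (z + of_nat p) = slash k A F z" if "z \<in> upper_half_plane" for z
        using inv unfolding F_def by (intro slash_periodic[OF A that])
    qed
  qed
  then show ?thesis
    using inv eta_quotient_holomorphic[OF p0] unfolding modular_forms_def F_def
    by (auto simp: eta_quotient_def on_uhp_def)
qed

text \<open>The quotient is the m-th power of \<open>f\<^sub>1\<close> or \<open>f\<^sub>2\<close>,
  and each of these has weight (p - 1)/2.\<close>

lemma eta_quotient_invariant:
  assumes p: "prime p" "p > 3" and M: "M \<in> Gamma1 p" and z: "z \<in> upper_half_plane"
    and rs: "r = int p * m \<and> s = - m \<or> r = - m \<and> s = int p * m"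
  shows "slash (int ((p - 1) div 2) * m) M (eta_quotient p r s) z = eta_quotient p r s z"
proof -
  define n where "n = (p - 1) div 2"
  have M': "M \<in> SL2Z" "[M $ 2 $ 2 = 1] (mod int p)" "[M $ 2 $ 1 = 0] (mod int p)" "[M $ 1 $ 1 = 1] (mod int p)"
    using M by (auto simp: Gamma1_def)
  have tau: "Im z > 0"
    using z by (simp add: uhp_iff)
  note facts = p M'(1)[unfolded SL2Z_det] tau M'(2-4)
  define f\<^sub>1 f\<^sub>2 where "f\<^sub>1 z = dedekind_eta z ^ p / dedekind_eta (of_nat p * z)"
    and "f\<^sub>2 z = dedekind_eta (of_nat p * z) ^ p / dedekind_eta z" for z
  define f where "f = (if s = - m \<and> r = int p * m then f\<^sub>1 else f\<^sub>2)"
  have "f\<^sub>1 (moebius M z) = automorphy M z ^ n * f\<^sub>1 z"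
    unfolding f\<^sub>1_def moebius_def automorphy_def n_def by (rule eta_quotient_Gamma1[OF facts])
  moreover have "f\<^sub>2 (moebius M z) = automorphy M z ^ n * f\<^sub>2 z"
    unfolding f\<^sub>2_def moebius_def automorphy_def n_def by (rule eta_quotient_Gamma1_Fricke[OF facts])
  ultimately have f: "f (moebius M z) = automorphy M z ^ n * f z"
    by (simp add: f_def)
  have powi: "x powi (int p * m) * y powi (- m) = (x ^ p / y) powi m" for x y :: complex
    by (simp add: power_int_mult power_int_mult_distrib power_int_inverse power_int_minus divide_inverse)
  have F: "eta_quotient p r s w = f w powi m" if "w \<in> upper_half_plane" for w
  proof (cases "s = - m \<and> r = int p * m")
    case True
    then show ?thesis
      using that by (simp add: f_def f\<^sub>1_def eta_quotient_def on_uhp_def powi)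
  next
    case False
    then have "r = - m" "s = int p * m" "f = f\<^sub>2"
      using rs by (auto simp: f_def)
    then show ?thesis
      using that powi[of "dedekind_eta (of_nat p * w)" "dedekind_eta w"]
      by (simp add: f\<^sub>2_def eta_quotient_def on_uhp_def mult.commute)
  qed
  have "slash (int n * m) M (eta_quotient p r s) z = automorphy M z powi (- (int n * m)) * (automorphy M z ^ n * f z) powi m"
    unfolding slash_def automorphy_def[symmetric] F[OF moebius_uhp[OF M'(1) z]] f ..
  also have "\<dots> = f z powi m"
    using automorphy_nonzero[OF M'(1) z] by (simp add: power_int_mult_distrib power_int_mult power_int_minus)
  finally show ?thesis
    unfolding n_def F[OF z] .
qed

section \<open>Weight and classification of the non-cuspidal eta quotients\<close>

lemma eta_quotient_weight:
  assumes p: "prime p"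
    and F: "eta_quotient p r s \<in> modular_forms k p"
  shows "r + s = 2 * k"
proof -
  \<comment> \<open>A matrix in Gamma1(p) that fixes neither i nor the modulus of the automorphy
    factor there, which is |1 + pi| > 1. Since p divides its lower left entry, the constants in
    \<open>norm_slash_eta_quotient\<close> are trivial, and invariance leaves only a power of
    \<open>x\<close> that must be 1.\<close>
  define A :: "int^2^2" where "A = vector [vector [1, 0], vector [int p, 1]]"
  have entries: "A $ 1 $ 1 = 1" "A $ 1 $ 2 = 0" "A $ 2 $ 1 = int p" "A $ 2 $ 2 = 1"
    by (simp_all add: A_def)
  have A: "A \<in> SL2Z" "A \<in> Gamma1 p"
    by (auto simp: Gamma1_def SL2Z_det entries cong_0_iff)
  have p0: "p > 0"
    using p by (simp add: prime_gt_0_nat)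
  have i: "\<i> \<in> upper_half_plane"
    by (simp add: uhp_iff)
  define x where "x = sqrt (norm (automorphy A \<i>))"
  have "x > 1"
  proof -
    have "Re (automorphy A \<i>) = 1" "Im (automorphy A \<i>) = real p"
      by (simp_all add: automorphy_def entries)
    then show ?thesis
      using p0 by (simp add: x_def cmod_def)
  qed
  obtain C \<alpha> \<beta> :: real where C: "\<alpha> = (if int p dvd A $ 2 $ 1 then real p else 1 / real p)"
    "norm (slash k A (eta_quotient p r s) \<i>) =
      sqrt (norm (automorphy A \<i>)) powi (r + s - 2 * k) *
      (C * (norm (dedekind_eta \<i>) powi r * norm (dedekind_eta (of_real \<alpha> * \<i> + of_real \<beta>)) powi s))"
    "int p dvd A $ 2 $ 1 \<Longrightarrow> C = 1 \<and> \<beta> = 0"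
    using norm_slash_eta_quotient[OF p A(1)] i by metis
  have "norm (slash k A (eta_quotient p r s) \<i>) = x powi (r + s - 2 * k) * norm (eta_quotient p r s \<i>)"
    using C i by (simp add: entries eta_quotient_def on_uhp_def norm_mult norm_power_int x_def)
  moreover have "slash k A (eta_quotient p r s) \<i> = eta_quotient p r s \<i>"
    using F A i by (simp add: modular_forms_def)
  ultimately have "x powi (r + s - 2 * k) = 1"
    using eta_quotient_nonzero[OF p0 i] by simp
  then have "r + s - 2 * k = 0"
    using \<open>x > 1\<close> by (metis power_int_0_right power_int_strict_increasing linorder_neq_iff)
  then show ?thesis
    by simp
qed

text \<open>A modular form has both orders nonnegative, and a nonzero constant term at some A makes
  one of them vanish. One vanishing order makes r or s equal to -p times the other, and r + s = 2k
  then determines k.\<close>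

lemma eta_quotient_noncuspidal_iff:
  assumes p: "prime p" "p > 3"
  shows "eta_quotient p r s \<in> modular_forms k p - cusp_forms k p \<longleftrightarrow>
    (\<exists>m\<ge>0. k = int ((p - 1) div 2) * m \<and> (r = int p * m \<and> s = - m \<or> r = - m \<and> s = int p * m))"
    (is "?L \<longleftrightarrow> ?R")
proof -
  define n where "n = (p - 1) div 2"
  have "odd p"
    using p prime_odd_nat by auto
  then have pn: "int p = 2 * int n + 1"
    by (auto simp: n_def elim!: oddE)
  define F where "F = eta_quotient p r s"
  \<comment> \<open>Representatives of the two cases in which p divides the lower left entry or
    not.\<close>
  define T S :: "int^2^2" where "T = vector [vector [1, 0], vector [0, 1]]" and "S = vector [vector [0, - 1], vector [1, 0]]"
  have T: "T \<in> SL2Z" "int p dvd T $ 2 $ 1"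
    by (simp_all add: SL2Z_det T_def)
  have S: "S \<in> SL2Z" "\<not> int p dvd S $ 2 $ 1"
    using p by (simp_all add: SL2Z_det S_def)
  have ord_T: "real_of_int r + (if int p dvd T $ 2 $ 1 then real p else 1 / real p) * real_of_int s = real_of_int (r + int p * s)"
    and ord_S: "real_of_int r + (if int p dvd S $ 2 $ 1 then real p else 1 / real p) * real_of_int s =
      real_of_int (int p * r + s) / real p"
    using T S p by (simp_all add: field_simps)
  have ord: "real_of_int r + (if int p dvd A $ 2 $ 1 then real p else 1 / real p) * real_of_int s = 0 \<Longrightarrow>
      r + int p * s = 0 \<or> int p * r + s = 0" for A :: "int^2^2"
    using ord_T ord_S T S p by (cases "int p dvd A $ 2 $ 1") (auto simp del: of_int_add of_int_mult)
  show ?thesis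
  proof
    assume ?L
    then have F: "F \<in> modular_forms k p" "F \<notin> cusp_forms k p"
      by (auto simp: F_def)
    have k: "r + s = 2 * k"
      using eta_quotient_weight[OF p(1)] F by (simp add: F_def)
    have exp: "\<exists>a. fourier_expansion p (slash k A F) a" if "A \<in> SL2Z" for A
      using F that by (simp add: modular_forms_def)
    have "0 \<le> real_of_int (r + int p * s)" "0 \<le> real_of_int (int p * r + s) / real p"
      using exp[OF T(1)] exp[OF S(1)] eta_quotient_order(1)[OF p(1) T(1) k] eta_quotient_order(1)[OF p(1) S(1) k]
      unfolding F_def ord_T ord_S by blast+
    then have nonneg: "0 \<le> r + int p * s" "0 \<le> int p * r + s"
      using p by (simp_all add: zero_le_divide_iff del: of_int_add of_int_mult)
    from F obtain A where A: "A \<in> SL2Z" "\<not> (\<exists>a. fourier_expansion p (slash k A F) a \<and> a 0 = 0)"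
      by (auto simp: cusp_forms_def)
    then obtain a where "fourier_expansion p (slash k A F) a" "a 0 \<noteq> 0"
      using exp by blast
    then have "r + int p * s = 0 \<or> int p * r + s = 0"
      using eta_quotient_order(2)[OF p(1) A(1) k] ord[of A] by (auto simp: F_def)
    then show ?R
    proof
      assume "r + int p * s = 0"
      then have r: "r = - (int p * s)"
        by simp
      \<comment> \<open>With r = -ps the other order is s(1 - p^2), which must be
        nonnegative.\<close>
      have "s \<le> 0"
      proof (rule ccontr)
        assume "\<not> s \<le> 0"
        then have "s * 1 < s * (int p * int p)"
          using p by (intro mult_strict_left_mono) (auto simp: less_1_mult)
        with nonneg(2) show False
          by (simp add: r mult_ac)
      qed
      moreover have "k = int n * (- s)"
        using k by (simp add: r pn algebra_simps)
      ultimately show ?thesis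
        by (intro exI[of _ "- s"]) (auto simp: r n_def)
    next
      assume "int p * r + s = 0"
      then have s: "s = - (int p * r)"
        by simp
      have "r \<le> 0"
      proof (rule ccontr)
        assume "\<not> r \<le> 0"
        then have "r * 1 < r * (int p * int p)"
          using p by (intro mult_strict_left_mono) (auto simp: less_1_mult)
        with nonneg(1) show False
          by (simp add: s mult_ac)
      qed
      moreover have "k = int n * (- r)"
        using k by (simp add: s pn algebra_simps)
      ultimately show ?thesis
        by (intro exI[of _ "- r"]) (auto simp: s n_def)
    qed
  next
    assume ?R
    then obtain m where m: "m \<ge> 0" "k = int n * m" "r = int p * m \<and> s = - m \<or> r = - m \<and> s = int p * m"
      by (auto simp: n_def)
    have k: "r + s = 2 * k"
      using m by (auto simp: pn algebra_simps)
    have pp: "m \<le> int p * (int p * m)"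
    proof -
      have "1 * m \<le> (int p * int p) * m"
        using m p by (intro mult_right_mono) (auto simp: less_1_mult less_imp_le)
      then show ?thesis
        by (simp add: mult_ac)
    qed
    have M: "F \<in> modular_forms k p"
      unfolding F_def
    proof (rule eta_quotient_modular_form[OF p(1) k])
      show "r + int p * s \<ge> 0" "int p * r + s \<ge> 0"
        using m(3) pp by auto
      show "slash k M (eta_quotient p r s) z = eta_quotient p r s z" if "M \<in> Gamma1 p" "z \<in> upper_half_plane" for M z
        using eta_quotient_invariant[OF p that m(3)] by (simp add: m(2) n_def)
    qed
    have "F \<notin> cusp_forms k p"
    proof
      assume "F \<in> cusp_forms k p"
      then have cusp: "\<exists>a. fourier_expansion p (slash k A F) a \<and> a 0 = 0" if "A \<in> SL2Z" for A
        using that by (simp add: cusp_forms_def)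
      \<comment> \<open>A cusp form would have both orders nonzero, but in either case of
        \<open>m(3)\<close> one of them is zero and the other is (p^2 - 1)m, up to the factor
        1/p.\<close>
      have "real_of_int (r + int p * s) \<noteq> 0" "real_of_int (int p * r + s) / real p \<noteq> 0"
        using cusp[OF T(1)] cusp[OF S(1)] eta_quotient_order(2)[OF p(1) T(1) k] eta_quotient_order(2)[OF p(1) S(1) k]
        unfolding F_def ord_T ord_S by blast+
      with m(3) show False
        by auto
    qed
    with M show ?L
      by (simp add: F_def)
  qed
qed

text \<open>At i infinity the first quotient tends to 0, as its order is a positive multiple of (p^2
  - 1)m, while the modulus of the second tends to 1.\<close>

lemma eta_quotient_distinct:
  assumes p: "prime p" and m: "m > 0"
  shows "eta_quotient p (- m) (int p * m) \<noteq> eta_quotient p (int p * m) (- m)"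
proof
  assume eq: "eta_quotient p (- m) (int p * m) = eta_quotient p (int p * m) (- m)"
  have p0: "real p > 0" and p1: "real p > 1"
    using p prime_gt_0_nat prime_gt_1_nat by auto
  have lim: "((\<lambda>z. exp (pi / 12 * (r + real p * s) * Im z) * norm (eta_quotient p r s z)) \<longlongrightarrow> 1) at_i_infinity" for r s
    using norm_eta_at_i_infinity[OF p0, of r s 0]
  proof (rule Lim_transform_eventually)
    show "\<forall>\<^sub>F z in at_i_infinity. exp (pi / 12 * (r + real p * s) * Im z) *
        (norm (dedekind_eta z) powi r * norm (dedekind_eta (of_real (real p) * z + of_real 0)) powi s) =
        exp (pi / 12 * (r + real p * s) * Im z) * norm (eta_quotient p r s z)"
      using eventually_uhp_at_i_infinity
      by eventually_elim (simp add: eta_quotient_def on_uhp_def norm_mult norm_power_int)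
  qed
  define e where "e = pi / 12 * (- m + real p * (int p * m))"
  have "e > 0"
  proof -
    have "1 * real_of_int m < (real p * real p) * real_of_int m"
      using m p1 by (intro mult_strict_right_mono) (auto simp: less_1_mult)
    then show ?thesis
      by (simp add: e_def mult_ac)
  qed
  have "((\<lambda>z. exp (- (e * Im z)) * (exp (e * Im z) * norm (eta_quotient p (- m) (int p * m) z))) \<longlongrightarrow> 0 * 1) at_i_infinity"
    using lim[of "- m" "int p * m"] by (intro tendsto_mult tendsto_exp_at_i_infinity \<open>e > 0\<close>) (simp add: e_def)
  then have "((\<lambda>z. norm (eta_quotient p (- m) (int p * m) z)) \<longlongrightarrow> 0) at_i_infinity"
    by (simp add: exp_minus flip: mult.assoc)
  moreover have "((\<lambda>z. norm (eta_quotient p (int p * m) (- m) z)) \<longlongrightarrow> 1) at_i_infinity"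
    using lim[of "int p * m" "- m"] by simp
  ultimately show False
    unfolding eq using tendsto_unique[OF at_i_infinity_neq_bot] by fastforce
qed

theorem theorem5p4:
  fixes p :: nat and k :: int
  assumes "prime p" and "p > 3"
  shows "((modular_forms k p - cusp_forms k p) \<inter> eta_quotients p \<noteq> {} \<longleftrightarrow>
            0 \<le> k \<and> (int p - 1) div 2 dvd k) \<and>
         ((int p - 1) div 2 dvd k \<and> k > 0 \<longrightarrow>
            (modular_forms k p - cusp_forms k p) \<inter> eta_quotients p =
              {on_uhp (\<lambda>z. dedekind_eta (of_nat p * z) powi (2 * int p * k div (int p - 1)) /
                           dedekind_eta z powi (2 * k div (int p - 1))),
               on_uhp (\<lambda>z. dedekind_eta z powi (2 * int p * k div (int p - 1)) /
                           dedekind_eta (of_nat p * z) powi (2 * k div (int p - 1)))} \<and>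
            card ((modular_forms k p - cusp_forms k p) \<inter> eta_quotients p) = 2)"
proof -
  define n where "n = (p - 1) div 2"
  have "odd p"
    using assms prime_odd_nat by auto
  then have pn: "int p = 2 * int n + 1"
    by (auto simp: n_def elim!: oddE)
  have n: "(int p - 1) div 2 = int n" and n0: "n > 0"
    using pn assms by auto
  define E where "E = (modular_forms k p - cusp_forms k p) \<inter> eta_quotients p"
  have E: "E = {eta_quotient p r s | r s. \<exists>m\<ge>0. k = int n * m \<and>
      (r = int p * m \<and> s = - m \<or> r = - m \<and> s = int p * m)}"
    using eta_quotient_noncuspidal_iff[OF assms, of _ _ k] unfolding E_def eta_quotients_eq n_def by blast
  have "E \<noteq> {} \<longleftrightarrow> (\<exists>m\<ge>0. k = int n * m)"
    unfolding E by blast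
  also have "\<dots> \<longleftrightarrow> 0 \<le> k \<and> int n dvd k"
    using n0 by (auto simp: zero_le_mult_iff elim!: dvdE)
  finally have 1: "E \<noteq> {} \<longleftrightarrow> 0 \<le> k \<and> int n dvd k" .
  have 2: "E = {on_uhp (\<lambda>z. dedekind_eta (of_nat p * z) powi (2 * int p * k div (int p - 1)) /
                           dedekind_eta z powi (2 * k div (int p - 1))),
               on_uhp (\<lambda>z. dedekind_eta z powi (2 * int p * k div (int p - 1)) /
                           dedekind_eta (of_nat p * z) powi (2 * k div (int p - 1)))} \<and> card E = 2"
    if k: "int n dvd k" "k > 0"
  proof -
    from k(1) obtain m where m: "k = int n * m"
      by (elim dvdE)
    have "m > 0"
      using k(2) m n0 by (simp add: zero_less_mult_iff)
    have E': "E = {eta_quotient p (- m) (int p * m), eta_quotient p (int p * m) (- m)}"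
      unfolding E m using \<open>m > 0\<close> n0 by auto
    have nz: "int p - 1 \<noteq> 0"
      using assms by simp
    \<comment> \<open>As p - 1 = 2n and k = nm, both integer divisions in the exponents are
      exact.\<close>
    have "2 * int p * k = (int p - 1) * (int p * m)" "2 * k = (int p - 1) * m"
      unfolding m pn by (simp_all add: algebra_simps)
    then have exps: "2 * int p * k div (int p - 1) = int p * m" "2 * k div (int p - 1) = m"
      by (simp_all only: nonzero_mult_div_cancel_left[OF nz])
    have "eta_quotient p (- m) (int p * m) = on_uhp (\<lambda>z. dedekind_eta (of_nat p * z) powi (int p * m) / dedekind_eta z powi m)"
      "eta_quotient p (int p * m) (- m) = on_uhp (\<lambda>z. dedekind_eta z powi (int p * m) / dedekind_eta (of_nat p * z) powi m)"
      by (simp_all add: eta_quotient_def power_int_minus divide_inverse mult.commute)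
    with E' show ?thesis
      unfolding exps using eta_quotient_distinct[OF assms(1) \<open>m > 0\<close>] by simp
  qed
  from 1 2 show ?thesis
    unfolding n E_def[symmetric] by blast
qed

end
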